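(* Let $A$ be an infinite set and let $\mathcal{L}\in V(\Omega(A))$ be a partitionable algebra. Then $Z(\mathcal{L})$ is supercomplete if and only if every locally partitionable congruence on $\mathcal{L}$ is partitionable.
   Context: $\Omega(A)$ is the algebra with universe $A$ whose signature has a constant symbol $\hat a$ for each $a\in A$, interpreted as $a$, and an $n$-ary function symbol $\hat f$ for each function $f\colon A^n\to A$ (all finite $n$), interpreted as $f$. $V(\Omega(A))$ is the variety generated by $\Omega(A)$. An algebra $\mathcal{L}\in V(\Omega(A))$ is partitionable if there is an injective homomorphism $\mathcal{L}\to\Omega(A)^{I}$ for some set $I$. $Z(\mathcal{L})$ is the set of all homomorphisms $\mathcal{L}\to\Omega(A)$, with the uniformity it inherits as a subspace of $A^{\mathcal{L}}$, where $A$ has the discrete uniformity and $A^{\mathcal{L}}$ the product uniformity. A congruence $\theta$ on $\mathcal{L}$ is partitionable if $\mathcal{L}/\theta$ is partitionable. It is locally partitionable if for every finitely generated subalgebra $\mathcal{M}\subseteq\mathcal{L}$ the congruence $\theta\cap\mathcal{M}^{2}$ on $\mathcal{M}$ is partitionable. For a uniform space $(X,\mathcal{U})$, the hyperspace $H(X)$ is the set of all closed subsets of $X$ with the uniformity generated by the relations $\overline{E}$, $E\in\mathcal{U}$, where $(C,D)\in\overline{E}$ if and only if $C\subseteq E[D]$ and $D\subseteq E[C]$, with $E[D]=\{x\in X\mid (z,x)\in E\text{ for some }z\in D\}$. A separated uniform space $X$ is supercomplete if $H(X)$ is complete. *)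

theory Defs
  imports "HOL-Analysis.Abstract_Topology"
begin

section \<open>Universal algebra\<close>

record 's signature =
  symbols :: "'s set"
  arity :: "'s \<Rightarrow> nat"

record ('s, 'x) algebra =
  carrier :: "'x set"
  interp :: "'s \<Rightarrow> 'x list \<Rightarrow> 'x"

definition tuples :: "nat \<Rightarrow> 'x set \<Rightarrow> 'x list set" where
  "tuples n X = {xs. length xs = n \<and> set xs \<subseteq> X}"

definition is_algebra :: "'s signature \<Rightarrow> ('s, 'x) algebra \<Rightarrow> bool" where
  "is_algebra \<Sigma> L \<longleftrightarrow>
     (\<forall>s\<in>symbols \<Sigma>. \<forall>xs\<in>tuples (arity \<Sigma> s) (carrier L). interp L s xs \<in> carrier L)"

definition is_hom ::
  "'s signature \<Rightarrow> ('s, 'x) algebra \<Rightarrow> ('s, 'y) algebra \<Rightarrow> ('x \<Rightarrow> 'y) \<Rightarrow> bool" where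
  "is_hom \<Sigma> L M h \<longleftrightarrow> h \<in> carrier L \<rightarrow> carrier M \<and>
     (\<forall>s\<in>symbols \<Sigma>. \<forall>xs\<in>tuples (arity \<Sigma> s) (carrier L).
        h (interp L s xs) = interp M s (map h xs))"

definition power_algebra :: "('s, 'x) algebra \<Rightarrow> 'i set \<Rightarrow> ('s, 'i \<Rightarrow> 'x) algebra" where
  "power_algebra M I =
     \<lparr>carrier = I \<rightarrow>\<^sub>E carrier M,
      interp = (\<lambda>s xs. \<lambda>i\<in>I. interp M s (map (\<lambda>x. x i) xs))\<rparr>"

definition subuniverse :: "'s signature \<Rightarrow> ('s, 'x) algebra \<Rightarrow> 'x set \<Rightarrow> bool" where
  "subuniverse \<Sigma> L M \<longleftrightarrow> M \<subseteq> carrier L \<and>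
     (\<forall>s\<in>symbols \<Sigma>. \<forall>xs\<in>tuples (arity \<Sigma> s) M. interp L s xs \<in> M)"

definition restrict_algebra :: "('s, 'x) algebra \<Rightarrow> 'x set \<Rightarrow> ('s, 'x) algebra" where
  "restrict_algebra L M = L\<lparr>carrier := M\<rparr>"

definition generated :: "'s signature \<Rightarrow> ('s, 'x) algebra \<Rightarrow> 'x set \<Rightarrow> 'x set" where
  "generated \<Sigma> L G = \<Inter>{M. subuniverse \<Sigma> L M \<and> G \<subseteq> M}"

definition fin_gen_subuniverse :: "'s signature \<Rightarrow> ('s, 'x) algebra \<Rightarrow> 'x set \<Rightarrow> bool" where
  "fin_gen_subuniverse \<Sigma> L M \<longleftrightarrow>
     (\<exists>G. finite G \<and> G \<subseteq> carrier L \<and> M = generated \<Sigma> L G)"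

definition is_congruence :: "'s signature \<Rightarrow> ('s, 'x) algebra \<Rightarrow> ('x \<times> 'x) set \<Rightarrow> bool" where
  "is_congruence \<Sigma> L \<theta> \<longleftrightarrow> equiv (carrier L) \<theta> \<and>
     (\<forall>s\<in>symbols \<Sigma>. \<forall>xs\<in>tuples (arity \<Sigma> s) (carrier L). \<forall>ys\<in>tuples (arity \<Sigma> s) (carrier L).
        list_all2 (\<lambda>x y. (x, y) \<in> \<theta>) xs ys \<longrightarrow> (interp L s xs, interp L s ys) \<in> \<theta>)"

text \<open>
  \<open>listset Xs\<close> is the set of all lists of representatives of the classes in \<open>Xs\<close>; for a
  congruence, all values of the operation on such lists lie in one class, which is the result.
\<close>

definition quotient_algebra :: "('s, 'x) algebra \<Rightarrow> ('x \<times> 'x) set \<Rightarrow> ('s, 'x set) algebra" where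
  "quotient_algebra L \<theta> =
     \<lparr>carrier = carrier L // \<theta>,
      interp = (\<lambda>s Xs. \<theta> `` (interp L s ` listset Xs))\<rparr>"


section \<open>Identities and varieties\<close>

datatype 's trm = Var nat | App 's "'s trm list"

primrec wf_trm :: "'s signature \<Rightarrow> 's trm \<Rightarrow> bool" where
  "wf_trm \<Sigma> (Var v) \<longleftrightarrow> True"
| "wf_trm \<Sigma> (App s ts) \<longleftrightarrow>
     s \<in> symbols \<Sigma> \<and> length ts = arity \<Sigma> s \<and> list_all (\<lambda>b. b) (map (wf_trm \<Sigma>) ts)"

primrec eval_trm :: "('s, 'x) algebra \<Rightarrow> (nat \<Rightarrow> 'x) \<Rightarrow> 's trm \<Rightarrow> 'x" where
  "eval_trm L \<rho> (Var v) = \<rho> v"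
| "eval_trm L \<rho> (App s ts) = interp L s (map (eval_trm L \<rho>) ts)"

definition satisfies :: "('s, 'x) algebra \<Rightarrow> 's trm \<Rightarrow> 's trm \<Rightarrow> bool" where
  "satisfies L t u \<longleftrightarrow> (\<forall>\<rho>. range \<rho> \<subseteq> carrier L \<longrightarrow> eval_trm L \<rho> t = eval_trm L \<rho> u)"

text \<open>
  A variety is an equational class, so the variety generated by \<open>K\<close> consists of the algebras
  (of whatever carrier type) that satisfy all identities valid in \<open>K\<close>.
\<close>

definition in_variety_of ::
  "'s signature \<Rightarrow> ('s, 'y) algebra \<Rightarrow> ('s, 'x) algebra \<Rightarrow> bool" where
  "in_variety_of \<Sigma> K L \<longleftrightarrow> is_algebra \<Sigma> L \<and>
     (\<forall>t u. wf_trm \<Sigma> t \<longrightarrow> wf_trm \<Sigma> u \<longrightarrow> satisfies K t u \<longrightarrow> satisfies L t u)"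


section \<open>The algebra \<open>\<Omega>(A)\<close>\<close>

datatype 'a omega_sym = Const 'a | Fun nat "'a list \<Rightarrow> 'a"

text \<open>
  An \<open>n\<close>-ary function on \<open>A\<close> is an extensional function on \<open>n\<close>-tuples, so that distinct symbols
  \<open>Fun n f\<close> correspond to distinct pairs of \<open>n\<close> and a function from \<open>A\<^sup>n\<close> to \<open>A\<close>.
\<close>

definition omega_sig :: "'a set \<Rightarrow> 'a omega_sym signature" where
  "omega_sig A =
     \<lparr>symbols = Const ` A \<union> {Fun n f | n f. f \<in> tuples n A \<rightarrow>\<^sub>E A},
      arity = (\<lambda>s. case s of Const a \<Rightarrow> 0 | Fun n f \<Rightarrow> n)\<rparr>"

definition omega :: "'a set \<Rightarrow> ('a omega_sym, 'a) algebra" where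
  "omega A =
     \<lparr>carrier = A,
      interp = (\<lambda>s xs. case s of Const a \<Rightarrow> a | Fun n f \<Rightarrow> f xs)\<rparr>"

definition in_V_omega :: "'a set \<Rightarrow> ('a omega_sym, 'x) algebra \<Rightarrow> bool" where
  "in_V_omega A L \<longleftrightarrow> in_variety_of (omega_sig A) (omega A) L"

text \<open>
  The exponent \<open>I\<close> ranges over sets of the fixed type \<open>'x \<Rightarrow> 'a\<close>. Nothing is lost: by
  \<open>partitionable_if_embeds\<close> below, an embedding into a power with an exponent of any
  other type also yields one of this form.
\<close>

definition partitionable :: "'a set \<Rightarrow> ('a omega_sym, 'x) algebra \<Rightarrow> bool" where
  "partitionable A L \<longleftrightarrow> in_V_omega A L \<and>
     (\<exists>(I :: ('x \<Rightarrow> 'a) set) \<phi>.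
        is_hom (omega_sig A) L (power_algebra (omega A) I) \<phi> \<and> inj_on \<phi> (carrier L))"

definition partitionable_congruence ::
  "'a set \<Rightarrow> ('a omega_sym, 'x) algebra \<Rightarrow> ('x \<times> 'x) set \<Rightarrow> bool" where
  "partitionable_congruence A L \<theta> \<longleftrightarrow>
     is_congruence (omega_sig A) L \<theta> \<and> partitionable A (quotient_algebra L \<theta>)"

definition locally_partitionable_congruence ::
  "'a set \<Rightarrow> ('a omega_sym, 'x) algebra \<Rightarrow> ('x \<times> 'x) set \<Rightarrow> bool" where
  "locally_partitionable_congruence A L \<theta> \<longleftrightarrow>
     is_congruence (omega_sig A) L \<theta> \<and>
     (\<forall>M. fin_gen_subuniverse (omega_sig A) L M \<longrightarrow>
        partitionable_congruence A (restrict_algebra L M) (\<theta> \<inter> M \<times> M))"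

lemma partitionable_if_embeds:
  fixes I :: "'i set" and L :: "('a omega_sym, 'x) algebra"
  assumes L: "in_V_omega A L"
    and hom: "is_hom (omega_sig A) L (power_algebra (omega A) I) \<phi>"
    and inj: "inj_on \<phi> (carrier L)"
  shows "partitionable A L"
proof -
  let ?c = "\<lambda>i x. \<phi> x i"
  define J where "J = ?c ` I"
  define \<psi> where "\<psi> = (\<lambda>x. \<lambda>j\<in>J. j x)"
  have car: "\<phi> x \<in> I \<rightarrow>\<^sub>E A" if "x \<in> carrier L" for x
    using hom that by (auto simp: is_hom_def power_algebra_def omega_def)
  have "is_hom (omega_sig A) L (power_algebra (omega A) J) \<psi>"
    unfolding is_hom_def
  proof (intro conjI ballI)
    show "\<psi> \<in> carrier L \<rightarrow> carrier (power_algebra (omega A) J)"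
      using car by (fastforce simp: \<psi>_def power_algebra_def omega_def J_def PiE_iff)
  next
    fix s xs
    assume s: "s \<in> symbols (omega_sig A)"
      and xs: "xs \<in> tuples (arity (omega_sig A) s) (carrier L)"
    have eq: "\<phi> (interp L s xs) = interp (power_algebra (omega A) I) s (map \<phi> xs)"
      using hom s xs by (simp add: is_hom_def)
    show "\<psi> (interp L s xs) = interp (power_algebra (omega A) J) s (map \<psi> xs)"
    proof
      fix j
      show "\<psi> (interp L s xs) j = interp (power_algebra (omega A) J) s (map \<psi> xs) j"
      proof (cases "j \<in> J")
        case True
        then obtain i where i: "i \<in> I" "j = ?c i"
          by (auto simp: J_def)
        have "\<phi> (interp L s xs) i = interp (omega A) s (map (\<lambda>x. \<phi> x i) xs)"
          using i by (simp add: eq power_algebra_def comp_def)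
        moreover have "map (\<lambda>x. \<psi> x j) xs = map (\<lambda>x. \<phi> x i) xs"
          using True i by (simp add: \<psi>_def)
        ultimately show ?thesis
          using True i by (simp add: \<psi>_def power_algebra_def comp_def)
      qed (simp add: \<psi>_def power_algebra_def)
    qed
  qed
  moreover have "inj_on \<psi> (carrier L)"
  proof (rule inj_onI)
    fix x y
    assume xy: "x \<in> carrier L" "y \<in> carrier L" and eq: "\<psi> x = \<psi> y"
    have "\<phi> x i = \<phi> y i" if "i \<in> I" for i
    proof -
      have "?c i \<in> J"
        using that by (simp add: J_def)
      then show ?thesis
        using fun_cong[OF eq, of "?c i"] by (simp add: \<psi>_def)
    qed
    then have "\<phi> x = \<phi> y"
      using car[OF xy(1)] car[OF xy(2)] by (intro PiE_ext)
    then show "x = y"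
      using inj xy by (simp add: inj_on_def)
  qed
  ultimately show ?thesis
    using L unfolding partitionable_def by blast
qed


section \<open>Uniform spaces with explicit carrier\<close>

text \<open>
  As in the type class \<^class>\<open>uniform_space\<close>, a uniformity is given by its filter of entourages.
  The carrier is kept explicit, since the spaces needed here are function spaces and
  hyperspaces whose points do not fill a type.
\<close>

definition uniform_on :: "'x set \<Rightarrow> ('x \<times> 'x) filter \<Rightarrow> bool" where
  "uniform_on X U \<longleftrightarrow> U \<le> principal (X \<times> X) \<and>
     (\<forall>E. eventually E U \<longrightarrow> (\<forall>x\<in>X. E (x, x))) \<and>
     (\<forall>E. eventually E U \<longrightarrow> eventually (\<lambda>(x, y). E (y, x)) U) \<and>
     (\<forall>E. eventually E U \<longrightarrow>
        (\<exists>D. eventually D U \<and> (\<forall>x y z. D (x, y) \<longrightarrow> D (y, z) \<longrightarrow> E (x, z))))"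

definition separated_on :: "'x set \<Rightarrow> ('x \<times> 'x) filter \<Rightarrow> bool" where
  "separated_on X U \<longleftrightarrow>
     (\<forall>x\<in>X. \<forall>y\<in>X. (\<forall>E. eventually E U \<longrightarrow> E (x, y)) \<longrightarrow> x = y)"

text \<open>
  \<open>F \<times>\<^sub>F F \<le> U\<close> says that \<open>F\<close> is Cauchy, \<open>filtermap (Pair x) F \<le> U\<close> that \<open>F\<close> converges to \<open>x\<close>.
\<close>

definition complete_on :: "'x set \<Rightarrow> ('x \<times> 'x) filter \<Rightarrow> bool" where
  "complete_on X U \<longleftrightarrow>
     (\<forall>F. F \<le> principal X \<longrightarrow> F \<noteq> bot \<longrightarrow> F \<times>\<^sub>F F \<le> U \<longrightarrow>
        (\<exists>x\<in>X. filtermap (Pair x) F \<le> U))"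

definition uniform_topology :: "'x set \<Rightarrow> ('x \<times> 'x) filter \<Rightarrow> 'x topology" where
  "uniform_topology X U =
     topology (\<lambda>S. S \<subseteq> X \<and> (\<forall>x\<in>S. eventually (\<lambda>(x', y). x' = x \<longrightarrow> y \<in> S) U))"

lemma openin_uniform_topology:
  "openin (uniform_topology X U) S \<longleftrightarrow>
     S \<subseteq> X \<and> (\<forall>x\<in>S. eventually (\<lambda>(x', y). x' = x \<longrightarrow> y \<in> S) U)"
proof -
  let ?P = "\<lambda>S. S \<subseteq> X \<and> (\<forall>x\<in>S. eventually (\<lambda>(x', y). x' = x \<longrightarrow> y \<in> S) U)"
  have "istopology ?P"
    unfolding istopology_def
  proof (intro conjI allI impI)
    fix S T assume ST: "?P S" "?P T"
    show "S \<inter> T \<subseteq> X" using ST by auto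
    show "\<forall>x\<in>S \<inter> T. eventually (\<lambda>(x', y). x' = x \<longrightarrow> y \<in> S \<inter> T) U"
    proof
      fix x assume "x \<in> S \<inter> T"
      then have "eventually (\<lambda>(x', y). x' = x \<longrightarrow> y \<in> S) U"
        and "eventually (\<lambda>(x', y). x' = x \<longrightarrow> y \<in> T) U"
        using ST by auto
      then show "eventually (\<lambda>(x', y). x' = x \<longrightarrow> y \<in> S \<inter> T) U"
        by eventually_elim auto
    qed
  next
    fix \<K> assume K: "\<forall>S\<in>\<K>. ?P S"
    show "\<Union>\<K> \<subseteq> X" using K by auto
    show "\<forall>x\<in>\<Union>\<K>. eventually (\<lambda>(x', y). x' = x \<longrightarrow> y \<in> \<Union>\<K>) U"
    proof
      fix x assume "x \<in> \<Union>\<K>"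
      then obtain S where S: "S \<in> \<K>" "x \<in> S" by auto
      then have "eventually (\<lambda>(x', y). x' = x \<longrightarrow> y \<in> S) U"
        using K by auto
      then show "eventually (\<lambda>(x', y). x' = x \<longrightarrow> y \<in> \<Union>\<K>) U"
        by eventually_elim (use S in auto)
    qed
  qed
  then show ?thesis
    by (simp add: uniform_topology_def topology_inverse')
qed

lemma topspace_uniform_topology:
  assumes "uniform_on X U"
  shows "topspace (uniform_topology X U) = X"
proof
  show "topspace (uniform_topology X U) \<subseteq> X"
    using openin_topspace[of "uniform_topology X U"] unfolding openin_uniform_topology by blast
  have "eventually (\<lambda>p. p \<in> X \<times> X) U"
    using assms by (simp add: uniform_on_def le_principal)
  then have "openin (uniform_topology X U) X"
    by (auto simp: openin_uniform_topology elim!: eventually_mono)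
  then show "X \<subseteq> topspace (uniform_topology X U)"
    by (rule openin_subset)
qed

definition discrete_uniformity :: "'x set \<Rightarrow> ('x \<times> 'x) filter" where
  "discrete_uniformity X = principal (Id_on X)"

definition product_uniformity ::
  "'i set \<Rightarrow> ('i \<Rightarrow> 'x set) \<Rightarrow> ('i \<Rightarrow> ('x \<times> 'x) filter) \<Rightarrow> (('i \<Rightarrow> 'x) \<times> ('i \<Rightarrow> 'x)) filter" where
  "product_uniformity I X U =
     inf (INF i\<in>I. filtercomap (\<lambda>(f, g). (f i, g i)) (U i))
         (principal (Pi\<^sub>E I X \<times> Pi\<^sub>E I X))"

definition subspace_uniformity :: "'x set \<Rightarrow> ('x \<times> 'x) filter \<Rightarrow> ('x \<times> 'x) filter" where
  "subspace_uniformity S U = inf U (principal (S \<times> S))"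

definition hyperspace :: "'x set \<Rightarrow> ('x \<times> 'x) filter \<Rightarrow> 'x set set" where
  "hyperspace X U = {C. closedin (uniform_topology X U) C}"

definition hyperspace_uniformity ::
  "'x set \<Rightarrow> ('x \<times> 'x) filter \<Rightarrow> ('x set \<times> 'x set) filter" where
  "hyperspace_uniformity X U =
     (INF E\<in>{E. eventually (\<lambda>p. p \<in> E) U}.
        principal {(C, D). C \<in> hyperspace X U \<and> D \<in> hyperspace X U \<and>
                           C \<subseteq> E `` D \<and> D \<subseteq> E `` C})"

definition supercomplete :: "'x set \<Rightarrow> ('x \<times> 'x) filter \<Rightarrow> bool" where
  "supercomplete X U \<longleftrightarrow> uniform_on X U \<and> separated_on X U \<and>
     complete_on (hyperspace X U) (hyperspace_uniformity X U)"


section \<open>The space \<open>Z(L)\<close>\<close>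

definition Z :: "'a set \<Rightarrow> ('a omega_sym, 'x) algebra \<Rightarrow> ('x \<Rightarrow> 'a) set" where
  "Z A L = {h \<in> carrier L \<rightarrow>\<^sub>E A. is_hom (omega_sig A) L (omega A) h}"

definition Z_uniformity ::
  "'a set \<Rightarrow> ('a omega_sym, 'x) algebra \<Rightarrow> (('x \<Rightarrow> 'a) \<times> ('x \<Rightarrow> 'a)) filter" where
  "Z_uniformity A L =
     subspace_uniformity (Z A L)
       (product_uniformity (carrier L) (\<lambda>_. A) (\<lambda>_. discrete_uniformity A))"

lemma eventually_Z_uniformity:
  fixes L :: "('a omega_sym, 'x) algebra"
  shows "eventually E (Z_uniformity A L) \<longleftrightarrow>
     (\<exists>K. finite K \<and> K \<subseteq> carrier L \<and>
        (\<forall>f\<in>Z A L. \<forall>g\<in>Z A L. (\<forall>x\<in>K. f x = g x) \<longrightarrow> E (f, g)))"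
proof -
  let ?c = "\<lambda>x. (\<lambda>(f, g). (f x, g x)) -` Id_on A :: (('x \<Rightarrow> 'a) \<times> ('x \<Rightarrow> 'a)) set"
  let ?S = "(carrier L \<rightarrow>\<^sub>E A) \<times> (carrier L \<rightarrow>\<^sub>E A) \<inter> Z A L \<times> Z A L"
  have Z: "Z A L \<subseteq> carrier L \<rightarrow>\<^sub>E A"
    by (auto simp: Z_def)
  have comap: "filtercomap (\<lambda>(f, g). (f x, g x)) (principal (Id_on A)) = principal (?c x)"
    for x :: 'x
    by (rule filtercomap_principal)
  have "eventually E (Z_uniformity A L) \<longleftrightarrow>
      eventually (\<lambda>p. p \<in> ?S \<longrightarrow> E p) (INF x\<in>carrier L. principal (?c x))"
    by (simp add: Z_uniformity_def subspace_uniformity_def product_uniformity_def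
        discrete_uniformity_def comap inf_assoc eventually_inf_principal)
  also have "\<dots> \<longleftrightarrow> (\<exists>K. K \<subseteq> carrier L \<and> finite K \<and>
      (\<forall>p\<in>\<Inter>(?c ` K). p \<in> ?S \<longrightarrow> E p))"
  proof -
    have "eventually Q (INF x\<in>K. principal (?c x)) \<longleftrightarrow> (\<forall>p\<in>\<Inter>(?c ` K). Q p)"
      if "finite K" for K Q
      using INF_principal_finite[OF that, of ?c] by (simp only: eventually_principal)
    then show ?thesis
      unfolding eventually_INF[of _ _ "carrier L"] by (intro ex_cong1 conj_cong refl)
  qed
  also have "\<dots> \<longleftrightarrow> (\<exists>K. finite K \<and> K \<subseteq> carrier L \<and>
        (\<forall>f\<in>Z A L. \<forall>g\<in>Z A L. (\<forall>x\<in>K. f x = g x) \<longrightarrow> E (f, g)))"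
  proof -
    have "(\<forall>p\<in>\<Inter>(?c ` K). p \<in> ?S \<longrightarrow> E p) \<longleftrightarrow>
        (\<forall>f\<in>Z A L. \<forall>g\<in>Z A L. (\<forall>x\<in>K. f x = g x) \<longrightarrow> E (f, g))"
      if K: "K \<subseteq> carrier L" for K
    proof -
      have "(f, g) \<in> \<Inter>(?c ` K) \<and> (f, g) \<in> ?S \<longleftrightarrow>
          f \<in> Z A L \<and> g \<in> Z A L \<and> (\<forall>x\<in>K. f x = g x)" for f g
      proof -
        have "f x \<in> A" if "f \<in> Z A L" "x \<in> K" for x
          using that Z K by (meson PiE_mem subsetD)
        then show ?thesis
          using Z by (auto simp: Id_on_iff)
      qed
      then show ?thesis
        unfolding Ball_def split_paired_All by blast
    qed
    then show ?thesis
      by (simp only: conj_ac cong: conj_cong)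
  qed
  finally show ?thesis .
qed

lemma uniform_on_Z: "uniform_on (Z A L) (Z_uniformity A L)"
  unfolding uniform_on_def
proof (intro conjI allI impI)
  show "Z_uniformity A L \<le> principal (Z A L \<times> Z A L)"
    by (simp add: Z_uniformity_def subspace_uniformity_def)
next
  fix E assume "eventually E (Z_uniformity A L)"
  then obtain K where K: "finite K" "K \<subseteq> carrier L"
    and E: "\<And>f g. f \<in> Z A L \<Longrightarrow> g \<in> Z A L \<Longrightarrow> \<forall>x\<in>K. f x = g x \<Longrightarrow> E (f, g)"
    by (auto simp: eventually_Z_uniformity)
  show "\<forall>f\<in>Z A L. E (f, f)"
    using E by auto
  show "eventually (\<lambda>(f, g). E (g, f)) (Z_uniformity A L)"
    unfolding eventually_Z_uniformity using K E by (intro exI[of _ K]) auto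
  show "\<exists>D. eventually D (Z_uniformity A L) \<and> (\<forall>f g h. D (f, g) \<longrightarrow> D (g, h) \<longrightarrow> E (f, h))"
  proof (intro exI conjI)
    let ?D = "\<lambda>(f, g). f \<in> Z A L \<and> g \<in> Z A L \<and> (\<forall>x\<in>K. f x = g x)"
    show "eventually ?D (Z_uniformity A L)"
      unfolding eventually_Z_uniformity using K by (intro exI[of _ K]) auto
    show "\<forall>f g h. ?D (f, g) \<longrightarrow> ?D (g, h) \<longrightarrow> E (f, h)"
      using E by auto
  qed
qed

lemma separated_on_Z: "separated_on (Z A L) (Z_uniformity A L)"
  unfolding separated_on_def
proof (intro ballI impI)
  fix f g assume fg: "f \<in> Z A L" "g \<in> Z A L"
    and all: "\<forall>E. eventually E (Z_uniformity A L) \<longrightarrow> E (f, g)"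
  have "f x = g x" if "x \<in> carrier L" for x
  proof -
    have "eventually (\<lambda>(f, g). f x = g x) (Z_uniformity A L)"
      unfolding eventually_Z_uniformity using that by (intro exI[of _ "{x}"]) auto
    then show ?thesis using all by auto
  qed
  then show "f = g"
    using fg by (intro PiE_ext[of f "carrier L" "\<lambda>_. A" g]) (auto simp: Z_def)
qed

end

theory Submission
  imports Defs
begin

text \<open>
  A congruence is partitionable iff it is the common kernel of a set of homomorphisms to
  \<open>\<Omega>(A)\<close>, and then that set may be taken closed. Since \<open>A\<close> is infinite, pairing on \<open>A\<close> codes
  finitely many elements of \<open>L\<close> by a single \<open>x\<close>, so that a finitely generated subalgebra has the
  form \<open>{f(x) | f : A \<rightarrow> A}\<close> and the uniformity of \<open>Z(L)\<close> has a base indexed by single elements: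
  two closed sets are \<open>x\<close>-close in the hyperspace iff they take the same values at \<open>x\<close>.
  A locally partitionable congruence amounts to a coherent family of value sets
  \<open>B x \<subseteq> A\<close>, with \<open>f(x) \<theta> g(x)\<close> iff \<open>f = g\<close> on \<open>B x\<close>; such families are exactly the data of Cauchy
  filters of closed sets, and the filter converges to \<open>C\<close> iff \<open>\<theta>\<close> is the common kernel of \<open>C\<close>.
\<close>

section \<open>Homomorphisms and common kernels\<close>

lemma wf_eval_in_carrier:
  assumes "is_algebra \<Sigma> L" "range \<rho> \<subseteq> carrier L" "wf_trm \<Sigma> t"
  shows "eval_trm L \<rho> t \<in> carrier L"
  using assms(3)
proof (induction t)
  case (Var v)
  then show ?case using assms(2) by auto
next
  case (App s ts)
  then have "map (eval_trm L \<rho>) ts \<in> tuples (arity \<Sigma> s) (carrier L)"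
    by (auto simp: tuples_def list_all_iff)
  then show ?case using App.prems assms(1) by (auto simp: is_algebra_def)
qed

lemma hom_eval_trm:
  assumes "is_algebra \<Sigma> L" "is_hom \<Sigma> L M h" "range \<rho> \<subseteq> carrier L" "wf_trm \<Sigma> t"
  shows "h (eval_trm L \<rho> t) = eval_trm M (h \<circ> \<rho>) t"
  using assms(4)
proof (induction t)
  case (Var v)
  then show ?case by simp
next
  case (App s ts)
  have "map (eval_trm L \<rho>) ts \<in> tuples (arity \<Sigma> s) (carrier L)"
    using App.prems wf_eval_in_carrier[OF assms(1,3)] by (auto simp: tuples_def list_all_iff)
  then have "h (eval_trm L \<rho> (App s ts)) = interp M s (map h (map (eval_trm L \<rho>) ts))"
    using App.prems assms(2) by (auto simp: is_hom_def)
  moreover have "map h (map (eval_trm L \<rho>) ts) = map (eval_trm M (h \<circ> \<rho>)) ts"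
    using App by (auto simp: list_all_iff comp_def)
  ultimately show ?case by (simp only: eval_trm.simps)
qed

text \<open>Homomorphisms commute with term evaluation, so under every \<open>h\<close> both sides
  of an identity of \<open>K\<close> get the same value, and separation makes them equal in
  \<open>L\<close>. This puts quotients by common kernels into the variety.\<close>

lemma in_variety_if_homs_separate:
  fixes L :: "('s, 'c) algebra" and K :: "('s, 'd) algebra"
  assumes L: "is_algebra \<Sigma> L"
    and sep: "\<And>x y. \<lbrakk>x \<in> carrier L; y \<in> carrier L; \<And>h. is_hom \<Sigma> L K h \<Longrightarrow> h x = h y\<rbrakk> \<Longrightarrow> x = y"
  shows "in_variety_of \<Sigma> K L"
  unfolding in_variety_of_def satisfies_def
proof (intro conjI allI impI L)
  fix t u and \<rho> :: "nat \<Rightarrow> 'c"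
  assume t: "wf_trm \<Sigma> t" and u: "wf_trm \<Sigma> u" and \<rho>: "range \<rho> \<subseteq> carrier L"
    and K: "\<forall>\<rho>. range \<rho> \<subseteq> carrier K \<longrightarrow> eval_trm K \<rho> t = eval_trm K \<rho> u"
  show "eval_trm L \<rho> t = eval_trm L \<rho> u"
  proof (rule sep)
    fix h assume h: "is_hom \<Sigma> L K h"
    then have "range (h \<circ> \<rho>) \<subseteq> carrier K" using \<rho> by (fastforce simp: is_hom_def)
    then show "h (eval_trm L \<rho> t) = h (eval_trm L \<rho> u)"
      using K by (simp add: hom_eval_trm[OF L h \<rho>] t u)
  qed (use wf_eval_in_carrier[OF L \<rho>] t u in auto)
qed

lemma is_hom_power_component:
  assumes "is_hom \<Sigma> L (power_algebra M I) \<phi>" "i \<in> I"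
  shows "is_hom \<Sigma> L M (\<lambda>x. \<phi> x i)"
  using assms by (fastforce simp: is_hom_def power_algebra_def comp_def)

lemma is_hom_comp:
  assumes "is_hom \<Sigma> L M g" "is_hom \<Sigma> M N h"
  shows "is_hom \<Sigma> L N (h \<circ> g)"
  unfolding is_hom_def
proof (intro conjI ballI)
  show "h \<circ> g \<in> carrier L \<rightarrow> carrier N" using assms by (auto simp: is_hom_def)
  fix s xs assume s: "s \<in> symbols \<Sigma>" and xs: "xs \<in> tuples (arity \<Sigma> s) (carrier L)"
  then have "map g xs \<in> tuples (arity \<Sigma> s) (carrier M)"
    using assms(1) by (fastforce simp: tuples_def is_hom_def)
  then show "(h \<circ> g) (interp L s xs) = interp N s (map (h \<circ> g) xs)"
    using assms s xs by (simp add: is_hom_def)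
qed

text \<open>\<open>Z A L\<close> contains only functions extensional on the carrier. Restriction
  brings a homomorphism into that form; the homomorphism law survives because the operations stay in
  the carrier.\<close>

lemma restrict_in_Z:
  assumes "is_algebra (omega_sig A) L" "is_hom (omega_sig A) L (omega A) h"
  shows "restrict h (carrier L) \<in> Z A L"
proof -
  have "is_hom (omega_sig A) L (omega A) (restrict h (carrier L))"
    unfolding is_hom_def
  proof (intro conjI ballI)
    fix s xs
    assume *: "s \<in> symbols (omega_sig A)" "xs \<in> tuples (arity (omega_sig A) s) (carrier L)"
    have "map (restrict h (carrier L)) xs = map h xs"
      using *(2) by (auto simp: tuples_def)
    then show "restrict h (carrier L) (interp L s xs)
        = interp (omega A) s (map (restrict h (carrier L)) xs)"
      using * assms by (simp add: is_hom_def is_algebra_def del: map_eq_conv)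
  qed (use assms(2) in \<open>auto simp: is_hom_def\<close>)
  moreover have "h \<in> carrier L \<rightarrow> A" using assms(2) by (auto simp: is_hom_def omega_def)
  ultimately show ?thesis
    by (auto simp: Z_def)
qed

text \<open>The kernel of the map from \<open>L\<close> into the power with exponent
  \<open>C\<close> whose coordinates are the members of \<open>C\<close>. For empty \<open>C\<close>
  it is the full relation on the carrier.\<close>

definition common_kernel :: "('s, 'x) algebra \<Rightarrow> ('x \<Rightarrow> 'a) set \<Rightarrow> ('x \<times> 'x) set" where
  "common_kernel L C = {(x, y). x \<in> carrier L \<and> y \<in> carrier L \<and> (\<forall>h\<in>C. h x = h y)}"

lemma equiv_common_kernel: "equiv (carrier L) (common_kernel L C)"
  by (auto simp: common_kernel_def intro!: equivI refl_onI symI transI)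

lemma congruence_common_kernel:
  assumes L: "is_algebra (omega_sig A) L" and C: "C \<subseteq> Z A L"
  shows "is_congruence (omega_sig A) L (common_kernel L C)"
  unfolding is_congruence_def
proof (intro conjI ballI impI equiv_common_kernel)
  fix s xs ys
  assume *: "s \<in> symbols (omega_sig A)" "xs \<in> tuples (arity (omega_sig A) s) (carrier L)"
    "ys \<in> tuples (arity (omega_sig A) s) (carrier L)"
    and rel: "list_all2 (\<lambda>x y. (x, y) \<in> common_kernel L C) xs ys"
  have "h (interp L s xs) = h (interp L s ys)" if "h \<in> C" for h
  proof -
    have "map h xs = map h ys"
      using rel that by (auto simp: list_all2_conv_all_nth common_kernel_def intro!: nth_equalityI)
    moreover have "is_hom (omega_sig A) L (omega A) h" using that C by (auto simp: Z_def)
    ultimately show ?thesis using * by (simp add: is_hom_def)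
  qed
  then show "(interp L s xs, interp L s ys) \<in> common_kernel L C"
    using L * by (auto simp: common_kernel_def is_algebra_def)
qed

section \<open>Quotient algebras and the criterion for partitionable congruences\<close>

lemma listset_iff: "xs \<in> listset Xs \<longleftrightarrow> list_all2 (\<in>) xs Xs"
  by (induction Xs arbitrary: xs) (auto simp: set_Cons_def list_all2_Cons2)

text \<open>The lists in the \<open>listset\<close> are those related entrywise to
  \<open>xs\<close>. Compatibility sends all of them into one class, and by reflexivity
  \<open>xs\<close> itself is among them, so the result is exactly that class.\<close>

lemma quotient_interp_classes:
  assumes L: "is_algebra \<Sigma> L" and \<theta>: "is_congruence \<Sigma> L \<theta>"
    and s: "s \<in> symbols \<Sigma>" and xs: "xs \<in> tuples (arity \<Sigma> s) (carrier L)"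
  shows "interp (quotient_algebra L \<theta>) s (map (\<lambda>x. \<theta> `` {x}) xs) = \<theta> `` {interp L s xs}"
proof -
  have eq: "equiv (carrier L) \<theta>" using \<theta> by (simp add: is_congruence_def)
  have ls: "ys \<in> listset (map (\<lambda>x. \<theta> `` {x}) xs) \<longleftrightarrow> list_all2 (\<lambda>x y. (x, y) \<in> \<theta>) xs ys" for ys
    by (auto simp: listset_iff list_all2_conv_all_nth)
  have refl: "list_all2 (\<lambda>x y. (x, y) \<in> \<theta>) xs xs"
    using xs eq by (intro list.rel_refl_strong) (auto simp: tuples_def equiv_def refl_on_def)
  have cls: "\<theta> `` {interp L s ys} = \<theta> `` {interp L s xs}"
    if "list_all2 (\<lambda>x y. (x, y) \<in> \<theta>) xs ys" for ys
  proof -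
    have "ys \<in> tuples (arity \<Sigma> s) (carrier L)"
      using that xs equiv_type[OF eq]
      by (auto simp: tuples_def list_all2_conv_all_nth in_set_conv_nth subset_iff)
    then have "(interp L s xs, interp L s ys) \<in> \<theta>"
      using \<theta> s xs that by (auto simp: is_congruence_def)
    then show ?thesis using equiv_class_eq[OF eq] by blast
  qed
  have "\<theta> `` (interp L s ` listset (map (\<lambda>x. \<theta> `` {x}) xs)) = \<theta> `` {interp L s xs}"
  proof (intro equalityI subsetI)
    fix z assume "z \<in> \<theta> `` (interp L s ` listset (map (\<lambda>x. \<theta> `` {x}) xs))"
    then obtain ys where "ys \<in> listset (map (\<lambda>x. \<theta> `` {x}) xs)" "z \<in> \<theta> `` {interp L s ys}"
      by blast
    then show "z \<in> \<theta> `` {interp L s xs}" using cls ls by blast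
  next
    fix z assume "z \<in> \<theta> `` {interp L s xs}"
    moreover have "xs \<in> listset (map (\<lambda>x. \<theta> `` {x}) xs)" using refl ls by blast
    ultimately show "z \<in> \<theta> `` (interp L s ` listset (map (\<lambda>x. \<theta> `` {x}) xs))" by blast
  qed
  then show ?thesis by (simp add: quotient_algebra_def)
qed

lemma carrier_quotient: "carrier (quotient_algebra L \<theta>) = carrier L // \<theta>"
  by (simp add: quotient_algebra_def)

lemma is_hom_quotient:
  assumes "is_algebra \<Sigma> L" "is_congruence \<Sigma> L \<theta>"
  shows "is_hom \<Sigma> L (quotient_algebra L \<theta>) (\<lambda>x. \<theta> `` {x})"
  using quotient_interp_classes[OF assms]
  by (auto simp: is_hom_def quotient_algebra_def quotientI)

lemma tuples_quotientE:
  assumes "Xs \<in> tuples n (S // \<theta>)"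
  obtains xs where "xs \<in> tuples n S" "Xs = map (\<lambda>x. \<theta> `` {x}) xs"
proof -
  have "\<exists>xs. set xs \<subseteq> S \<and> Xs = map (\<lambda>x. \<theta> `` {x}) xs" if "set Xs \<subseteq> S // \<theta>"
    using that
  proof (induction Xs)
    case (Cons X Xs)
    then obtain x xs where "x \<in> S" "X = \<theta> `` {x}" "set xs \<subseteq> S" "Xs = map (\<lambda>x. \<theta> `` {x}) xs"
      by (auto elim!: quotientE)
    then show ?case by (intro exI[of _ "x # xs"]) auto
  qed auto
  moreover have "length Xs = n" "set Xs \<subseteq> S // \<theta>" using assms by (auto simp: tuples_def)
  ultimately obtain xs where "set xs \<subseteq> S" "Xs = map (\<lambda>x. \<theta> `` {x}) xs" by blast
  then show ?thesis using \<open>length Xs = n\<close> by (intro that[of xs]) (auto simp: tuples_def)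
qed

lemma is_algebra_quotient:
  assumes "is_algebra \<Sigma> L" "is_congruence \<Sigma> L \<theta>"
  shows "is_algebra \<Sigma> (quotient_algebra L \<theta>)"
  unfolding is_algebra_def
proof (intro ballI)
  fix s Xs assume s: "s \<in> symbols \<Sigma>"
    and Xs: "Xs \<in> tuples (arity \<Sigma> s) (carrier (quotient_algebra L \<theta>))"
  from Xs obtain xs where xs: "xs \<in> tuples (arity \<Sigma> s) (carrier L)" "Xs = map (\<lambda>x. \<theta> `` {x}) xs"
    by (auto simp: quotient_algebra_def elim: tuples_quotientE)
  have "interp L s xs \<in> carrier L" using assms(1) s xs by (auto simp: is_algebra_def)
  then show "interp (quotient_algebra L \<theta>) s Xs \<in> carrier (quotient_algebra L \<theta>)"
    unfolding xs(2) quotient_interp_classes[OF assms s xs(1)]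
    by (simp add: quotient_algebra_def quotientI)
qed

text \<open>Each \<open>h\<close> in \<open>C\<close> is constant on the classes of the common
  kernel, so it factors through the quotient; \<open>the_elem\<close> picks out the single value on
  a class.\<close>

lemma common_kernel_class_hom:
  assumes L: "is_algebra (omega_sig A) L" and C: "C \<subseteq> Z A L" and h: "h \<in> C"
  shows "is_hom (omega_sig A) (quotient_algebra L (common_kernel L C)) (omega A)
    (\<lambda>X. the_elem (h ` X))"
    and "x \<in> carrier L \<Longrightarrow> the_elem (h ` (common_kernel L C `` {x})) = h x"
proof -
  let ?\<theta> = "common_kernel L C"
  have val: "the_elem (h ` (?\<theta> `` {x})) = h x" if "x \<in> carrier L" for x
  proof -
    have "h ` (?\<theta> `` {x}) = {h x}"
      using that h by (auto simp: common_kernel_def image_iff)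
    then show ?thesis by simp
  qed
  then show "x \<in> carrier L \<Longrightarrow> the_elem (h ` (?\<theta> `` {x})) = h x" .
  have hom: "is_hom (omega_sig A) L (omega A) h" using C h by (auto simp: Z_def)
  show "is_hom (omega_sig A) (quotient_algebra L ?\<theta>) (omega A) (\<lambda>X. the_elem (h ` X))"
    unfolding is_hom_def
  proof (intro conjI ballI)
    show "(\<lambda>X. the_elem (h ` X)) \<in> carrier (quotient_algebra L ?\<theta>) \<rightarrow> carrier (omega A)"
      using hom val by (auto simp: quotient_algebra_def is_hom_def elim!: quotientE)
  next
    fix s Xs assume s: "s \<in> symbols (omega_sig A)"
      and "Xs \<in> tuples (arity (omega_sig A) s) (carrier (quotient_algebra L ?\<theta>))"
    then obtain xs where xs: "xs \<in> tuples (arity (omega_sig A) s) (carrier L)"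
      "Xs = map (\<lambda>x. ?\<theta> `` {x}) xs"
      by (auto simp: quotient_algebra_def elim: tuples_quotientE)
    have eq: "map (\<lambda>X. the_elem (h ` X)) Xs = map h xs"
      using xs val by (auto simp: tuples_def)
    have "interp L s xs \<in> carrier L" using L s xs(1) by (auto simp: is_algebra_def)
    then have "the_elem (h ` interp (quotient_algebra L ?\<theta>) s Xs) = h (interp L s xs)"
      unfolding xs(2) quotient_interp_classes[OF L congruence_common_kernel[OF L C] s xs(1)]
      by (rule val)
    then show "the_elem (h ` interp (quotient_algebra L ?\<theta>) s Xs)
        = interp (omega A) s (map (\<lambda>X. the_elem (h ` X)) Xs)"
      unfolding eq using hom s xs(1) by (simp add: is_hom_def)
  qed
qed

text \<open>The coordinates of an embedding of the quotient, composed with the quotient map, form a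
  suitable \<open>C\<close>. Conversely, the members of \<open>C\<close> factor through the quotient
  and serve as the coordinates of an embedding.\<close>

lemma partitionable_congruence_iff:
  fixes L :: "('a omega_sym, 'x) algebra"
  assumes L: "is_algebra (omega_sig A) L"
  shows "partitionable_congruence A L \<theta> \<longleftrightarrow> (\<exists>C\<subseteq>Z A L. \<theta> = common_kernel L C)"
proof
  assume pc: "partitionable_congruence A L \<theta>"
  then have cong: "is_congruence (omega_sig A) L \<theta>"
    by (simp add: partitionable_congruence_def)
  then have eq: "equiv (carrier L) \<theta>" by (simp add: is_congruence_def)
  let ?q = "\<lambda>x. \<theta> `` {x}"
  obtain I :: "('x set \<Rightarrow> 'a) set" and \<phi> where
    \<phi>: "is_hom (omega_sig A) (quotient_algebra L \<theta>) (power_algebra (omega A) I) \<phi>"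
    and inj: "inj_on \<phi> (carrier L // \<theta>)"
    using pc unfolding partitionable_congruence_def partitionable_def
    by (auto simp: carrier_quotient)
  define C where "C = (\<lambda>i. restrict (\<lambda>x. \<phi> (?q x) i) (carrier L)) ` I"
  have "C \<subseteq> Z A L"
    unfolding C_def
    using restrict_in_Z[OF L is_hom_comp[OF is_hom_quotient[OF L cong] is_hom_power_component[OF \<phi>]]]
    by (auto simp: comp_def)
  moreover have "\<theta> = common_kernel L C"
  proof -
    have "(x, y) \<in> \<theta> \<longleftrightarrow> (\<forall>h\<in>C. h x = h y)" if xy: "x \<in> carrier L" "y \<in> carrier L" for x y
    proof -
      have ext: "\<phi> (?q x) \<in> I \<rightarrow>\<^sub>E A" if "x \<in> carrier L" for x
        using \<phi> that
        by (auto simp: is_hom_def power_algebra_def omega_def quotient_algebra_def quotientI Pi_iff)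
      have "(x, y) \<in> \<theta> \<longleftrightarrow> ?q x = ?q y"
        using eq_equiv_class_iff[OF eq xy] by simp
      also have "\<dots> \<longleftrightarrow> \<phi> (?q x) = \<phi> (?q y)"
        using inj_on_eq_iff[OF inj quotientI[OF xy(1)] quotientI[OF xy(2)]] by simp
      also have "\<dots> \<longleftrightarrow> (\<forall>i\<in>I. \<phi> (?q x) i = \<phi> (?q y) i)"
        using PiE_ext[OF ext[OF xy(1)] ext[OF xy(2)]] by auto
      finally show ?thesis using xy by (simp add: C_def)
    qed
    moreover have "\<theta> \<subseteq> carrier L \<times> carrier L" using eq by (simp add: equiv_def refl_on_def)
    ultimately show ?thesis by (auto simp: common_kernel_def)
  qed
  ultimately show "\<exists>C\<subseteq>Z A L. \<theta> = common_kernel L C" by blast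
next
  assume "\<exists>C\<subseteq>Z A L. \<theta> = common_kernel L C"
  then obtain C where C: "C \<subseteq> Z A L" and \<theta>: "\<theta> = common_kernel L C" by blast
  have cong: "is_congruence (omega_sig A) L \<theta>"
    using congruence_common_kernel[OF L C] \<theta> by simp
  let ?Q = "quotient_algebra L \<theta>"
  let ?\<phi> = "\<lambda>X. \<lambda>h\<in>C. the_elem (h ` X)"
  note hom = common_kernel_class_hom[OF L C, folded \<theta>]
  have sep: "X = Y" if XY: "X \<in> carrier ?Q" "Y \<in> carrier ?Q"
    and e: "\<And>h. h \<in> C \<Longrightarrow> the_elem (h ` X) = the_elem (h ` Y)" for X Y
  proof -
    obtain x y where xy: "x \<in> carrier L" "y \<in> carrier L" "X = \<theta> `` {x}" "Y = \<theta> `` {y}"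
      using XY by (auto simp: quotient_algebra_def elim!: quotientE)
    then have "(x, y) \<in> \<theta>" using e hom(2) by (auto simp: \<theta> common_kernel_def)
    then show ?thesis using equiv_class_eq[OF equiv_common_kernel] xy by (metis \<theta>)
  qed
  have "in_V_omega A ?Q"
    unfolding in_V_omega_def
    by (rule in_variety_if_homs_separate[OF is_algebra_quotient[OF L cong] sep]) (use hom(1) in auto)
  moreover have "is_hom (omega_sig A) ?Q (power_algebra (omega A) C) ?\<phi>"
    using hom(1) by (fastforce simp: is_hom_def power_algebra_def comp_def cong: restrict_cong)
  moreover have "inj_on ?\<phi> (carrier ?Q)"
  proof (intro inj_onI sep)
    fix X Y h assume eq: "?\<phi> X = ?\<phi> Y" and "h \<in> C"
    have "?\<phi> X h = ?\<phi> Y h" by (simp only: eq)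
    then show "the_elem (h ` X) = the_elem (h ` Y)" using \<open>h \<in> C\<close> by simp
  qed
  \<comment> \<open>The exponent \<open>C\<close> consists of functions on \<open>L\<close>, whereas
    \<open>partitionable\<close> asks for an exponent of functions on the quotient; this lemma
    changes the exponent.\<close>
  ultimately have "partitionable A ?Q" by (rule partitionable_if_embeds)
  then show "partitionable_congruence A L \<theta>"
    using cong by (simp add: partitionable_congruence_def)
qed

text \<open>The coordinates of an embedding, restricted to the carrier, lie in \<open>Z A L\<close>.
  The main argument uses the partitionability of \<open>L\<close> in this form.\<close>

lemma partitionable_Z_separates:
  fixes L :: "('a omega_sym, 'x) algebra"
  assumes L: "is_algebra (omega_sig A) L" and "partitionable A L"
    and xy: "x \<in> carrier L" "y \<in> carrier L" and eq: "\<And>h. h \<in> Z A L \<Longrightarrow> h x = h y"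
  shows "x = y"
proof -
  obtain I :: "('x \<Rightarrow> 'a) set" and \<phi> where
    \<phi>: "is_hom (omega_sig A) L (power_algebra (omega A) I) \<phi>"
    and inj: "inj_on \<phi> (carrier L)"
    using assms(2) by (auto simp: partitionable_def)
  have "\<phi> x i = \<phi> y i" if "i \<in> I" for i
    using eq[OF restrict_in_Z[OF L is_hom_power_component[OF \<phi> that]]] xy by simp
  moreover have "\<phi> x \<in> I \<rightarrow>\<^sub>E A" "\<phi> y \<in> I \<rightarrow>\<^sub>E A"
    using \<phi> xy by (auto simp: is_hom_def power_algebra_def omega_def Pi_iff)
  ultimately have "\<phi> x = \<phi> y" by (meson PiE_ext)
  then show ?thesis using inj xy by (simp add: inj_on_def)
qed

section \<open>Unary operations and coding of tuples\<close>

lemma is_algebra_omega: "is_algebra (omega_sig A) (omega A)"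
  by (auto simp: is_algebra_def omega_sig_def omega_def)

lemma subuniverse_carrier: "is_algebra \<Sigma> L \<Longrightarrow> subuniverse \<Sigma> L (carrier L)"
  by (simp add: subuniverse_def is_algebra_def)

lemma subuniverse_generated:
  assumes "is_algebra \<Sigma> L" "G \<subseteq> carrier L"
  shows "subuniverse \<Sigma> L (generated \<Sigma> L G)"
proof -
  have "generated \<Sigma> L G \<subseteq> carrier L"
    using subuniverse_carrier[OF assms(1)] assms(2) by (auto simp: generated_def)
  moreover have "interp L s xs \<in> generated \<Sigma> L G"
    if s: "s \<in> symbols \<Sigma>" and xs: "xs \<in> tuples (arity \<Sigma> s) (generated \<Sigma> L G)" for s xs
    unfolding generated_def
  proof (intro InterI, clarify)
    fix M assume M: "subuniverse \<Sigma> L M" "G \<subseteq> M"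
    then have "xs \<in> tuples (arity \<Sigma> s) M" using xs by (auto simp: tuples_def generated_def)
    then show "interp L s xs \<in> M" using M s by (auto simp: subuniverse_def)
  qed
  ultimately show ?thesis by (simp add: subuniverse_def)
qed

lemma is_algebra_restrict: "subuniverse \<Sigma> L M \<Longrightarrow> is_algebra \<Sigma> (restrict_algebra L M)"
  by (simp add: subuniverse_def is_algebra_def restrict_algebra_def)

lemma is_hom_restrict_algebra:
  assumes "is_hom \<Sigma> L K h" "M \<subseteq> carrier L"
  shows "is_hom \<Sigma> (restrict_algebra L M) K h"
proof -
  have "xs \<in> tuples n (carrier L)" if "xs \<in> tuples n M" for n and xs :: "'b list"
    using that assms(2) by (auto simp: tuples_def)
  then show ?thesis using assms by (auto simp: is_hom_def restrict_algebra_def)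
qed

text \<open>Operations act on lists, whence the \<open>hd\<close> of a one-element list. Restricting
  to \<open>tuples 1 A\<close> gives the extensional function that \<open>omega_sig\<close> demands,
  so any total \<open>f\<close> mapping \<open>A\<close> to \<open>A\<close> can be used and only
  its values on \<open>A\<close> matter.\<close>

definition unary :: "'a set \<Rightarrow> ('a omega_sym, 'x) algebra \<Rightarrow> ('a \<Rightarrow> 'a) \<Rightarrow> 'x \<Rightarrow> 'x" where
  "unary A L f x = interp L (Fun 1 (\<lambda>as\<in>tuples 1 A. f (hd as))) [x]"

lemma Fun_in_omega_sig:
  assumes "f \<in> tuples n A \<rightarrow> A"
  shows "Fun n (restrict f (tuples n A)) \<in> symbols (omega_sig A)"
    "arity (omega_sig A) (Fun n g) = n"
  using assms by (auto simp: omega_sig_def)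

lemma unary_fun_tuples: "f \<in> A \<rightarrow> A \<Longrightarrow> (\<lambda>as. f (hd as)) \<in> tuples 1 A \<rightarrow> A"
  by (auto simp: tuples_def length_Suc_conv)

lemma unary_in_subuniverse:
  assumes "subuniverse (omega_sig A) L M" "f \<in> A \<rightarrow> A" "x \<in> M"
  shows "unary A L f x \<in> M"
proof -
  let ?s = "Fun 1 (\<lambda>as\<in>tuples 1 A. f (hd as))"
  have "[x] \<in> tuples (arity (omega_sig A) ?s) M"
    using assms(3) by (simp add: tuples_def omega_sig_def)
  then show ?thesis
    using assms(1) Fun_in_omega_sig(1)[OF unary_fun_tuples[OF assms(2)]]
    unfolding subuniverse_def unary_def by blast
qed

lemma Z_in: "h \<in> Z A L \<Longrightarrow> x \<in> carrier L \<Longrightarrow> h x \<in> A"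
  by (auto simp: Z_def)

lemma Z_interp:
  assumes "h \<in> Z A L" "s \<in> symbols (omega_sig A)" "xs \<in> tuples (arity (omega_sig A) s) (carrier L)"
  shows "h (interp L s xs) = interp (omega A) s (map h xs)"
  using assms by (simp add: Z_def is_hom_def)

lemma Z_unary:
  assumes "h \<in> Z A L" "f \<in> A \<rightarrow> A" "x \<in> carrier L"
  shows "h (unary A L f x) = f (h x)"
proof -
  have "[x] \<in> tuples (arity (omega_sig A) (Fun 1 (\<lambda>as\<in>tuples 1 A. f (hd as)))) (carrier L)"
    using assms(3) by (simp add: tuples_def omega_sig_def)
  from Z_interp[OF assms(1) Fun_in_omega_sig(1)[OF unary_fun_tuples[OF assms(2)]] this]
  show ?thesis
    using Z_in[OF assms(1,3)] by (simp add: unary_def omega_def tuples_def)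
qed

section \<open>Value sets and the families that represent a congruence\<close>

definition vals :: "('x \<Rightarrow> 'a) set \<Rightarrow> 'x \<Rightarrow> 'a set" where
  "vals C x = (\<lambda>h. h x) ` C"

lemma vals_unary:
  assumes "C \<subseteq> Z A L" "f \<in> A \<rightarrow> A" "x \<in> carrier L"
  shows "vals C (unary A L f x) = f ` vals C x"
proof -
  have "h (unary A L f x) = f (h x)" if "h \<in> C" for h
    using Z_unary[OF _ assms(2,3)] assms(1) that by blast
  then show ?thesis by (simp add: vals_def image_image)
qed

lemma vals_subset: "C \<subseteq> Z A L \<Longrightarrow> x \<in> carrier L \<Longrightarrow> vals C x \<subseteq> A"
  by (auto simp: vals_def intro: Z_in)

text \<open>
  \<open>B x\<close> collects the values at \<open>x\<close> of the homomorphisms on the subalgebra generated by \<open>x\<close> whose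
  common kernel is the restriction of \<open>\<theta>\<close>; a homomorphism there is determined by its value at \<open>x\<close>.
\<close>

definition represents ::
  "'a set \<Rightarrow> ('a omega_sym, 'x) algebra \<Rightarrow> ('x \<times> 'x) set \<Rightarrow> ('x \<Rightarrow> 'a set) \<Rightarrow> bool" where
  "represents A L \<theta> B \<longleftrightarrow> (\<forall>x\<in>carrier L. B x \<subseteq> A \<and>
     (\<forall>f\<in>A \<rightarrow> A. \<forall>g\<in>A \<rightarrow> A. (unary A L f x, unary A L g x) \<in> \<theta> \<longleftrightarrow> (\<forall>a\<in>B x. f a = g a)))"

lemma represents_subset: "represents A L \<theta> B \<Longrightarrow> x \<in> carrier L \<Longrightarrow> B x \<subseteq> A"
  by (simp add: represents_def)

lemma represents_cong:
  assumes "\<And>x. x \<in> carrier L \<Longrightarrow> B x = B' x"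
  shows "represents A L \<theta> B \<longleftrightarrow> represents A L \<theta> B'"
  using assms by (simp add: represents_def)

lemma represents_iff:
  assumes "represents A L \<theta> B" "x \<in> carrier L" "f \<in> A \<rightarrow> A" "g \<in> A \<rightarrow> A"
  shows "(unary A L f x, unary A L g x) \<in> \<theta> \<longleftrightarrow> (\<forall>a\<in>B x. f a = g a)"
  using assms unfolding represents_def by blast

text \<open>For a point \<open>a\<close> of \<open>B'\<close> outside \<open>B\<close>, the constant
  function \<open>b\<close> and its modification with value \<open>a\<close> at \<open>a\<close>
  agree on \<open>B\<close> but not on \<open>B'\<close>. Hence a subset of \<open>A\<close> is
  determined by which functions agree on it.\<close>

lemma subset_if_agreement:
  assumes "infinite A" "B' \<subseteq> A"
    and agree: "\<And>f g. \<lbrakk>f \<in> A \<rightarrow> A; g \<in> A \<rightarrow> A; \<forall>a\<in>B. f a = g a\<rbrakk> \<Longrightarrow> \<forall>a\<in>B'. f a = g a"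
  shows "B' \<subseteq> B"
proof (rule ccontr)
  assume "\<not> B' \<subseteq> B"
  then obtain a where a: "a \<in> B'" "a \<notin> B" by blast
  then have "a \<in> A" using assms(2) by blast
  moreover obtain b where b: "b \<in> A" "b \<noteq> a"
    using assms(1) by (metis finite.emptyI finite_insert finite_subset insertI1 subsetI)
  ultimately have "\<forall>c\<in>B'. b = (if c = a then a else b)"
    using a(2) by (intro agree[of "\<lambda>_. b"]) auto
  then show False using a(1) b(2) by auto
qed

lemma represents_unique:
  assumes "infinite A" "represents A L \<theta> B" "represents A L \<theta> B'" "x \<in> carrier L"
  shows "B x = B' x"
proof -
  have sub: "C x \<subseteq> D x" if "represents A L \<theta> C" "represents A L \<theta> D" for C D
  proof (rule subset_if_agreement[OF assms(1)])
    show "C x \<subseteq> A" using that(1) assms(4) by (rule represents_subset)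
    fix f g assume "f \<in> A \<rightarrow> A" "g \<in> A \<rightarrow> A" "\<forall>a\<in>D x. f a = g a"
    then show "\<forall>a\<in>C x. f a = g a"
      using represents_iff[OF that(1) assms(4)] represents_iff[OF that(2) assms(4)] by blast
  qed
  show ?thesis using sub assms(2,3) by blast
qed

text \<open>Under \<open>h\<close> the elements \<open>f(x)\<close> and \<open>g(x)\<close> go to
  \<open>f (h x)\<close> and \<open>g (h x)\<close>; these coincide for all \<open>h\<close> in
  \<open>C\<close> exactly when \<open>f\<close> and \<open>g\<close> agree on the values of
  \<open>C\<close> at \<open>x\<close>.\<close>

lemma represents_common_kernel:
  assumes L: "is_algebra (omega_sig A) L" and C: "C \<subseteq> Z A L"
  shows "represents A L (common_kernel L C) (vals C)"
  unfolding represents_def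
proof (intro ballI conjI)
  fix x f g assume x: "x \<in> carrier L" and fg: "f \<in> A \<rightarrow> A" "g \<in> A \<rightarrow> A"
  have "h (unary A L f x) = f (h x) \<and> h (unary A L g x) = g (h x)" if "h \<in> C" for h
    using Z_unary[OF _ _ x, of h A] fg C that by auto
  moreover have "unary A L f x \<in> carrier L" "unary A L g x \<in> carrier L"
    using unary_in_subuniverse[OF subuniverse_carrier[OF L]] fg x by auto
  ultimately show "(unary A L f x, unary A L g x) \<in> common_kernel L C \<longleftrightarrow> (\<forall>a\<in>vals C x. f a = g a)"
    by (auto simp: common_kernel_def vals_def)
qed (rule vals_subset[OF C])

text \<open>By \<open>sep\<close>, equations between elements of \<open>L\<close> can be checked in
  \<open>A\<close> after applying an arbitrary member of \<open>Z A L\<close>.\<close>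

locale separated_omega_algebra =
  fixes A :: "'a set" and L :: "('a omega_sym, 'x) algebra"
  assumes inf: "infinite A"
    and alg: "is_algebra (omega_sig A) L"
    and sep: "\<lbrakk>x \<in> carrier L; y \<in> carrier L; \<And>h. h \<in> Z A L \<Longrightarrow> h x = h y\<rbrakk> \<Longrightarrow> x = y"
begin

lemma unary_closed: "f \<in> A \<rightarrow> A \<Longrightarrow> x \<in> carrier L \<Longrightarrow> unary A L f x \<in> carrier L"
  by (rule unary_in_subuniverse[OF subuniverse_carrier[OF alg]])

lemma unary_unary:
  assumes "f \<in> A \<rightarrow> A" "g \<in> A \<rightarrow> A" "x \<in> carrier L"
  shows "unary A L f (unary A L g x) = unary A L (\<lambda>a. f (g a)) x"
proof (rule sep)
  have fg: "(\<lambda>a. f (g a)) \<in> A \<rightarrow> A" using assms by auto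
  show "unary A L f (unary A L g x) \<in> carrier L" "unary A L (\<lambda>a. f (g a)) x \<in> carrier L"
    using assms fg by (auto intro!: unary_closed)
  fix h assume "h \<in> Z A L"
  then show "h (unary A L f (unary A L g x)) = h (unary A L (\<lambda>a. f (g a)) x)"
    using assms fg by (simp add: Z_unary unary_closed)
qed

text \<open>As \<open>A\<close> is infinite, there is a bijection from \<open>A \<times> A\<close>
  to \<open>A\<close>. The corresponding binary operation yields \<open>z\<close>, and the
  components of the inverse bijection, as unary operations, recover \<open>x\<close> and
  \<open>y\<close>; \<open>sep\<close> reduces this to a computation in \<open>A\<close>.\<close>

lemma pair_code:
  assumes M: "subuniverse (omega_sig A) L M" and xy: "x \<in> M" "y \<in> M"
  obtains z p q where "z \<in> M" "p \<in> A \<rightarrow> A" "q \<in> A \<rightarrow> A" "x = unary A L p z" "y = unary A L q z"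
proof -
  obtain \<pi> where \<pi>: "bij_betw \<pi> (A \<times> A) A"
    using card_of_Times_same_infinite[OF inf] card_of_ordIso by blast
  let ?f = "\<lambda>as. \<pi> (as ! 0, as ! 1)"
  let ?s = "Fun 2 (restrict ?f (tuples 2 A))"
  define z where "z = interp L ?s [x, y]"
  let ?inv = "inv_into (A \<times> A) \<pi>"
  let ?p = "\<lambda>a. fst (?inv a)" and ?q = "\<lambda>a. snd (?inv a)"
  have "?inv a \<in> A \<times> A" if "a \<in> A" for a
    using that \<pi> by (metis bij_betw_def inv_into_into)
  then have pq: "?p \<in> A \<rightarrow> A" "?q \<in> A \<rightarrow> A" by (auto simp: mem_Times_iff)
  have "?f \<in> tuples 2 A \<rightarrow> A"
    using bij_betw_apply[OF \<pi>] by (auto simp: tuples_def length_Suc_conv numeral_2_eq_2)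
  note s = Fun_in_omega_sig[OF this]
  have M_sub: "M \<subseteq> carrier L" using M by (simp add: subuniverse_def)
  have z: "z \<in> M"
    using M s xy unfolding subuniverse_def z_def by (auto simp: tuples_def)
  have hz: "h z = \<pi> (h x, h y)" if h: "h \<in> Z A L" for h
    using Z_interp[OF h s(1), of "[x, y]"] s(2) xy M_sub Z_in[OF h]
    by (auto simp: z_def tuples_def omega_def)
  have inv: "?inv (\<pi> (h x, h y)) = (h x, h y)" if h: "h \<in> Z A L" for h
    using \<pi> xy M_sub Z_in[OF h] by (intro inv_into_f_f) (auto simp: bij_betw_def)
  have "x = unary A L ?p z" "y = unary A L ?q z"
    using z xy M_sub pq inv by (auto intro!: sep unary_closed simp: Z_unary hz subset_iff)
  then show ?thesis using that z pq by blast
qed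

text \<open>Induction on \<open>G\<close>: the new element is paired with the code of the old ones,
  and the decoding functions are composed.\<close>

lemma finite_code:
  assumes M: "subuniverse (omega_sig A) L M" and "finite G" "G \<subseteq> M"
  shows "\<exists>z\<in>M. \<forall>y\<in>G. \<exists>f\<in>A \<rightarrow> A. y = unary A L f z"
  using assms(2,3)
proof (induction G)
  case empty
  \<comment> \<open>A code must exist in \<open>M\<close> even for empty \<open>G\<close>; a
    constant symbol supplies it. In particular the carrier is nonempty.\<close>
  obtain a where "a \<in> A" using inf by fastforce
  then have "interp L (Const a) [] \<in> M"
    using M by (auto simp: subuniverse_def omega_sig_def tuples_def)
  then show ?case by blast
next
  case (insert y G)
  then obtain z where z: "z \<in> M" "\<forall>y\<in>G. \<exists>f\<in>A \<rightarrow> A. y = unary A L f z" by auto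
  obtain w p q where w: "w \<in> M" "p \<in> A \<rightarrow> A" "q \<in> A \<rightarrow> A" "y = unary A L p w" "z = unary A L q w"
    using pair_code[OF M _ z(1), of y] insert.prems by blast
  have "w \<in> carrier L" using w(1) M by (auto simp: subuniverse_def)
  have "\<exists>f\<in>A \<rightarrow> A. u = unary A L f w" if u: "u \<in> G" for u
  proof -
    obtain f where f: "f \<in> A \<rightarrow> A" "u = unary A L f z" using z(2) u by blast
    then have "u = unary A L (\<lambda>a. f (q a)) w"
      using unary_unary w(3,5) \<open>w \<in> carrier L\<close> by blast
    moreover have "(\<lambda>a. f (q a)) \<in> A \<rightarrow> A" using f(1) w(3) by auto
    ultimately show ?thesis by blast
  qed
  then show ?case using w by blast
qed

text \<open>Applying an operation to elements \<open>f(x)\<close> for several \<open>f\<close> is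
  the same as applying to \<open>x\<close> one function, obtained by combining the \<open>f\<close>
  pointwise with that operation on \<open>A\<close>. This function is \<open>g\<close>
  below.\<close>

lemma subuniverse_unary_range:
  assumes x: "x \<in> carrier L"
  shows "subuniverse (omega_sig A) L {unary A L f x | f. f \<in> A \<rightarrow> A}"
  unfolding subuniverse_def
proof (intro conjI ballI)
  let ?N = "{unary A L f x | f. f \<in> A \<rightarrow> A}"
  show N: "?N \<subseteq> carrier L" using unary_closed x by blast
  fix s xs assume s: "s \<in> symbols (omega_sig A)" and xs: "xs \<in> tuples (arity (omega_sig A) s) ?N"
  then have "\<forall>y\<in>set xs. \<exists>f. f \<in> A \<rightarrow> A \<and> y = unary A L f x" by (auto simp: tuples_def)
  then obtain F where F: "\<And>y. y \<in> set xs \<Longrightarrow> F y \<in> A \<rightarrow> A \<and> y = unary A L (F y) x"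
    by (auto dest!: bchoice)
  define g where "g = (\<lambda>a. interp (omega A) s (map (\<lambda>y. F y a) xs))"
  have xsL: "xs \<in> tuples (arity (omega_sig A) s) (carrier L)"
    using xs N by (auto simp: tuples_def)
  have g: "g \<in> A \<rightarrow> A"
  proof
    fix a assume "a \<in> A"
    then have "map (\<lambda>y. F y a) xs \<in> tuples (arity (omega_sig A) s) (carrier (omega A))"
      using F xs by (auto simp: tuples_def omega_def)
    then have "g a \<in> carrier (omega A)"
      using is_algebra_omega s unfolding is_algebra_def g_def by blast
    then show "g a \<in> A" by (simp add: omega_def)
  qed
  have "interp L s xs = unary A L g x"
  proof (rule sep)
    show "interp L s xs \<in> carrier L" using alg s xsL by (auto simp: is_algebra_def)
    show "unary A L g x \<in> carrier L" using g x by (rule unary_closed)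
    fix h assume h: "h \<in> Z A L"
    have "h y = F y (h x)" if "y \<in> set xs" for y
      using F[OF that] Z_unary[OF h _ x] by metis
    then have "map h xs = map (\<lambda>y. F y (h x)) xs" by simp
    then show "h (interp L s xs) = h (unary A L g x)"
      using Z_interp[OF h s xsL] Z_unary[OF h g x] by (simp add: g_def del: map_eq_conv)
  qed
  then show "interp L s xs \<in> ?N" using g by blast
qed

text \<open>A code \<open>x\<close> of the generators, taken inside \<open>M\<close>, already
  generates \<open>M\<close>: the elements \<open>f(x)\<close> form a subuniverse containing the
  generators.\<close>

lemma fin_gen_code:
  assumes "fin_gen_subuniverse (omega_sig A) L M"
  obtains x where "x \<in> M" "\<And>y. y \<in> M \<Longrightarrow> \<exists>f\<in>A \<rightarrow> A. y = unary A L f x"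
proof -
  obtain G where G: "finite G" "G \<subseteq> carrier L" "M = generated (omega_sig A) L G"
    using assms by (auto simp: fin_gen_subuniverse_def)
  have M: "subuniverse (omega_sig A) L M"
    using subuniverse_generated[OF alg G(2)] G(3) by simp
  have "G \<subseteq> M" using G(3) by (auto simp: generated_def)
  then obtain x where x: "x \<in> M" "\<forall>y\<in>G. \<exists>f\<in>A \<rightarrow> A. y = unary A L f x"
    using finite_code[OF M G(1)] by blast
  have "x \<in> carrier L" using x(1) M by (auto simp: subuniverse_def)
  moreover have "G \<subseteq> {unary A L f x | f. f \<in> A \<rightarrow> A}" using x(2) by blast
  ultimately have "M \<subseteq> {unary A L f x | f. f \<in> A \<rightarrow> A}"
    using subuniverse_unary_range unfolding G(3) generated_def by blast
  then show ?thesis using that x(1) by blast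
qed

section \<open>Locally partitionable congruences\<close>

text \<open>Functions that agree on all values at \<open>x\<close> of members of
  \<open>Z A L\<close> give equal elements \<open>f(x) = g(x)\<close> by \<open>sep\<close>, hence
  related ones, and so agree on \<open>B x\<close>. Thus each point of \<open>B x\<close> is
  attained by a homomorphism on all of \<open>L\<close>.\<close>

lemma represents_vals_Z:
  assumes \<theta>: "is_congruence (omega_sig A) L \<theta>" and B: "represents A L \<theta> B" and x: "x \<in> carrier L"
  shows "B x \<subseteq> vals (Z A L) x"
proof (rule subset_if_agreement[OF inf])
  show "B x \<subseteq> A" using B x by (rule represents_subset)
  fix f g assume fg: "f \<in> A \<rightarrow> A" "g \<in> A \<rightarrow> A" and eq: "\<forall>a\<in>vals (Z A L) x. f a = g a"
  have "unary A L f x = unary A L g x"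
    using fg x eq by (auto intro!: sep unary_closed simp: Z_unary vals_def)
  moreover have "(unary A L f x, unary A L f x) \<in> \<theta>"
    using \<theta> unary_closed[OF fg(1) x] by (auto simp: is_congruence_def equiv_def refl_on_def)
  ultimately have "(unary A L f x, unary A L g x) \<in> \<theta>" by simp
  then show "\<forall>a\<in>B x. f a = g a"
    using represents_iff[OF B x fg] by blast
qed

text \<open>On the subalgebra generated by \<open>x\<close> the congruence is the common kernel of
  some set \<open>C\<close> of homomorphisms; the values of \<open>C\<close> at \<open>x\<close>
  serve as \<open>B x\<close>.\<close>

lemma locally_partitionable_imp_represents:
  assumes \<theta>: "locally_partitionable_congruence A L \<theta>"
  shows "\<exists>B. represents A L \<theta> B"
proof -
  let ?P = "\<lambda>x b. b \<subseteq> A \<and> (\<forall>f\<in>A \<rightarrow> A. \<forall>g\<in>A \<rightarrow> A.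
    (unary A L f x, unary A L g x) \<in> \<theta> \<longleftrightarrow> (\<forall>a\<in>b. f a = g a))"
  have "\<forall>x\<in>carrier L. \<exists>b. ?P x b"
  proof
    fix x assume x: "x \<in> carrier L"
    define M where "M = generated (omega_sig A) L {x}"
    have M: "subuniverse (omega_sig A) L M"
      unfolding M_def using x by (intro subuniverse_generated[OF alg]) auto
    have xM: "x \<in> M" by (auto simp: M_def generated_def)
    let ?R = "restrict_algebra L M"
    have R: "is_algebra (omega_sig A) ?R" by (rule is_algebra_restrict[OF M])
    have "fin_gen_subuniverse (omega_sig A) L M"
      unfolding fin_gen_subuniverse_def M_def using x by (intro exI[of _ "{x}"]) auto
    then have "partitionable_congruence A ?R (\<theta> \<inter> M \<times> M)"
      using \<theta> by (auto simp: locally_partitionable_congruence_def)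
    then obtain C where C: "C \<subseteq> Z A ?R" "\<theta> \<inter> M \<times> M = common_kernel ?R C"
      using partitionable_congruence_iff[OF R] by blast
    have xR: "x \<in> carrier ?R" using xM by (simp add: restrict_algebra_def)
    have un: "unary A ?R = unary A L"
      by (intro ext) (simp add: unary_def restrict_algebra_def)
    have iff: "(unary A L f x, unary A L g x) \<in> \<theta> \<longleftrightarrow> (\<forall>a\<in>vals C x. f a = g a)"
      if fg: "f \<in> A \<rightarrow> A" "g \<in> A \<rightarrow> A" for f g
    proof -
      have "(unary A L f x, unary A L g x) \<in> \<theta> \<longleftrightarrow>
          (unary A L f x, unary A L g x) \<in> \<theta> \<inter> M \<times> M"
        using unary_in_subuniverse[OF M _ xM] fg by blast
      then show ?thesis
        using represents_iff[OF represents_common_kernel[OF R C(1)] xR fg] C(2) un by simp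
    qed
    show "\<exists>b. ?P x b"
      by (intro exI[of _ "vals C x"] conjI ballI vals_subset[OF C(1) xR] iff)
  qed
  then show ?thesis unfolding represents_def by (rule bchoice)
qed

lemma represents_imp_locally_partitionable:
  assumes \<theta>: "is_congruence (omega_sig A) L \<theta>" and B: "represents A L \<theta> B"
  shows "locally_partitionable_congruence A L \<theta>"
  unfolding locally_partitionable_congruence_def
proof (intro conjI allI impI \<theta>)
  fix M assume fg: "fin_gen_subuniverse (omega_sig A) L M"
  then have M: "subuniverse (omega_sig A) L M"
    using subuniverse_generated[OF alg] by (auto simp: fin_gen_subuniverse_def)
  then have M_sub: "M \<subseteq> carrier L" by (simp add: subuniverse_def)
  obtain x where x: "x \<in> M" and code: "\<And>y. y \<in> M \<Longrightarrow> \<exists>f\<in>A \<rightarrow> A. y = unary A L f x"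
    using fin_gen_code[OF fg] by blast
  have xL: "x \<in> carrier L" using x M_sub by blast
  let ?R = "restrict_algebra L M"
  have R: "is_algebra (omega_sig A) ?R" by (rule is_algebra_restrict[OF M])
  have carR: "carrier ?R = M" by (simp add: restrict_algebra_def)
  \<comment> \<open>Since \<open>M\<close> consists of the elements \<open>f(x)\<close>, only values
    at \<open>x\<close> matter. By \<open>represents_vals_Z\<close> these fill all of
    \<open>B x\<close>, so the restrictions of \<open>D\<close> to \<open>M\<close> have the
    required kernel.\<close>
  define D where "D = {h \<in> Z A L. h x \<in> B x}"
  have D: "D \<subseteq> Z A L" by (auto simp: D_def)
  have vD: "vals D x = B x"
    using represents_vals_Z[OF \<theta> B xL] by (auto simp: D_def vals_def)
  define C where "C = (\<lambda>h. restrict h M) ` D"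
  have "C \<subseteq> Z A ?R"
  proof
    fix k assume "k \<in> C"
    then obtain h where "k = restrict h M" "h \<in> Z A L" by (auto simp: C_def D_def)
    then show "k \<in> Z A ?R"
      using restrict_in_Z[OF R is_hom_restrict_algebra[OF _ M_sub], of h] by (simp add: Z_def carR)
  qed
  moreover have "\<theta> \<inter> M \<times> M = common_kernel ?R C"
  proof -
    have "(y, z) \<in> \<theta> \<longleftrightarrow> (\<forall>k\<in>C. k y = k z)" if yz: "y \<in> M" "z \<in> M" for y z
    proof -
      obtain f g where f: "f \<in> A \<rightarrow> A" "y = unary A L f x" and g: "g \<in> A \<rightarrow> A" "z = unary A L g x"
        using code yz by metis
      have "(y, z) \<in> \<theta> \<longleftrightarrow> (\<forall>a\<in>vals D x. f a = g a)"
        using represents_iff[OF B xL f(1) g(1)] f(2) g(2) vD by simp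
      also have "\<dots> \<longleftrightarrow> (y, z) \<in> common_kernel L D"
        using represents_iff[OF represents_common_kernel[OF alg D] xL f(1) g(1)] f(2) g(2) by simp
      also have "\<dots> \<longleftrightarrow> (\<forall>k\<in>C. k y = k z)"
        using yz M_sub by (auto simp: common_kernel_def C_def)
      finally show ?thesis .
    qed
    then show ?thesis by (auto simp: common_kernel_def carR)
  qed
  ultimately show "partitionable_congruence A ?R (\<theta> \<inter> M \<times> M)"
    using partitionable_congruence_iff[OF R] by blast
qed

text \<open>Any two elements are \<open>p(z)\<close> and \<open>q(z)\<close> for a common code
  \<open>z\<close>, so whether they are related can be read off from \<open>B z\<close>.\<close>

lemma represents_inj:
  assumes "is_congruence (omega_sig A) L \<theta>" "is_congruence (omega_sig A) L \<theta>'"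
    and B: "represents A L \<theta> B" "represents A L \<theta>' B"
  shows "\<theta> = \<theta>'"
proof -
  have sub: "\<theta> \<subseteq> carrier L \<times> carrier L" "\<theta>' \<subseteq> carrier L \<times> carrier L"
    using assms(1,2) by (auto simp: is_congruence_def dest: equiv_type)
  have "(x, y) \<in> \<theta> \<longleftrightarrow> (x, y) \<in> \<theta>'" if xy: "x \<in> carrier L" "y \<in> carrier L" for x y
  proof -
    obtain z p q where z: "z \<in> carrier L" "p \<in> A \<rightarrow> A" "q \<in> A \<rightarrow> A"
      and eq: "x = unary A L p z" "y = unary A L q z"
      using pair_code[OF subuniverse_carrier[OF alg] xy] by blast
    show ?thesis unfolding eq represents_iff[OF B(1) z] represents_iff[OF B(2) z] ..
  qed
  then show ?thesis using sub by auto
qed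

text \<open>This is the coherence of the family: \<open>g(f(x))\<close> and \<open>k(f(x))\<close>
  are related iff \<open>g\<close> and \<open>k\<close> agree on the image of \<open>B x\<close>
  under \<open>f\<close>, and agreement determines the set.\<close>

lemma represents_unary:
  assumes B: "represents A L \<theta> B" and f: "f \<in> A \<rightarrow> A" and x: "x \<in> carrier L"
  shows "B (unary A L f x) = f ` B x"
proof -
  have fx: "unary A L f x \<in> carrier L" by (rule unary_closed[OF f x])
  have iff: "(\<forall>a\<in>B (unary A L f x). g a = k a) \<longleftrightarrow> (\<forall>a\<in>f ` B x. g a = k a)"
    if gk: "g \<in> A \<rightarrow> A" "k \<in> A \<rightarrow> A" for g k
  proof -
    have "(\<forall>a\<in>B (unary A L f x). g a = k a) \<longleftrightarrow>
        (unary A L g (unary A L f x), unary A L k (unary A L f x)) \<in> \<theta>"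
      using represents_iff[OF B fx gk] by blast
    also have "\<dots> \<longleftrightarrow> (unary A L (\<lambda>a. g (f a)) x, unary A L (\<lambda>a. k (f a)) x) \<in> \<theta>"
      using unary_unary f x gk by simp
    also have "\<dots> \<longleftrightarrow> (\<forall>a\<in>B x. g (f a) = k (f a))"
    proof -
      have "(\<lambda>a. g (f a)) \<in> A \<rightarrow> A" "(\<lambda>a. k (f a)) \<in> A \<rightarrow> A" using gk f by auto
      then show ?thesis using represents_iff[OF B x] by blast
    qed
    finally show ?thesis by simp
  qed
  have sub: "B (unary A L f x) \<subseteq> A" "f ` B x \<subseteq> A"
    using represents_subset[OF B fx] represents_subset[OF B x] f by auto
  show ?thesis
  proof
    show "B (unary A L f x) \<subseteq> f ` B x"
      by (rule subset_if_agreement[OF inf sub(1)]) (simp only: iff)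
    show "f ` B x \<subseteq> B (unary A L f x)"
      by (rule subset_if_agreement[OF inf sub(2)]) (simp only: iff)
  qed
qed

section \<open>The hyperspace\<close>

text \<open>A code \<open>x\<close> of the finite set \<open>K\<close> replaces \<open>K\<close>:
  homomorphisms that agree at \<open>x\<close> agree at every \<open>f(x)\<close>.\<close>

lemma eventually_Z_uniformity_point:
  "eventually E (Z_uniformity A L) \<longleftrightarrow>
     (\<exists>x\<in>carrier L. \<forall>f\<in>Z A L. \<forall>g\<in>Z A L. f x = g x \<longrightarrow> E (f, g))"
proof
  assume "eventually E (Z_uniformity A L)"
  then obtain K where K: "finite K" "K \<subseteq> carrier L"
    and E: "\<And>f g. f \<in> Z A L \<Longrightarrow> g \<in> Z A L \<Longrightarrow> \<forall>x\<in>K. f x = g x \<Longrightarrow> E (f, g)"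
    by (auto simp: eventually_Z_uniformity)
  obtain x where x: "x \<in> carrier L" "\<forall>y\<in>K. \<exists>f\<in>A \<rightarrow> A. y = unary A L f x"
    using finite_code[OF subuniverse_carrier[OF alg] K] by blast
  have "E (f, g)" if fg: "f \<in> Z A L" "g \<in> Z A L" and eq: "f x = g x" for f g
  proof (rule E[OF fg], rule)
    fix y assume "y \<in> K"
    then obtain u where "u \<in> A \<rightarrow> A" "y = unary A L u x" using x(2) by blast
    then show "f y = g y" using fg x(1) eq by (simp add: Z_unary)
  qed
  then show "\<exists>x\<in>carrier L. \<forall>f\<in>Z A L. \<forall>g\<in>Z A L. f x = g x \<longrightarrow> E (f, g)"
    using x(1) by blast
next
  assume "\<exists>x\<in>carrier L. \<forall>f\<in>Z A L. \<forall>g\<in>Z A L. f x = g x \<longrightarrow> E (f, g)"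
  then obtain x where "x \<in> carrier L" "\<forall>f\<in>Z A L. \<forall>g\<in>Z A L. f x = g x \<longrightarrow> E (f, g)" by blast
  then show "eventually E (Z_uniformity A L)"
    unfolding eventually_Z_uniformity by (intro exI[of _ "{x}"]) auto
qed

abbreviation H where "H \<equiv> hyperspace (Z A L) (Z_uniformity A L)"

text \<open>The sets of all \<open>g\<close> with \<open>g x = h x\<close>, for single
  \<open>x\<close>, form a neighbourhood base at \<open>h\<close>. So \<open>h\<close> lies in the
  closure of \<open>C\<close> iff for each \<open>x\<close> its value is attained by some member of
  \<open>C\<close>.\<close>

lemma hyperspace_iff:
  "C \<in> H \<longleftrightarrow> C \<subseteq> Z A L \<and> (\<forall>h\<in>Z A L. (\<forall>x\<in>carrier L. h x \<in> vals C x) \<longrightarrow> h \<in> C)"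
proof -
  have "eventually (\<lambda>(h', g). h' = h \<longrightarrow> g \<in> Z A L - C) (Z_uniformity A L) \<longleftrightarrow>
      (\<exists>x\<in>carrier L. h x \<notin> vals C x)" if "h \<in> Z A L" "C \<subseteq> Z A L" for h
    using that by (fastforce simp: eventually_Z_uniformity_point vals_def)
  then show ?thesis
    by (auto simp: hyperspace_def closedin_def topspace_uniform_topology[OF uniform_on_Z]
        openin_uniform_topology)
qed

lemma hyperspace_subset: "C \<in> H \<Longrightarrow> C \<subseteq> Z A L"
  by (simp add: hyperspace_iff)

text \<open>For the basic entourage of agreement at \<open>x\<close>, the two inclusions defining
  closeness say that \<open>C\<close> and \<open>D\<close> take the same values at
  \<open>x\<close>.\<close>

lemma eventually_hyperspace_uniformity:
  "eventually P (hyperspace_uniformity (Z A L) (Z_uniformity A L)) \<longleftrightarrow>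
     (\<exists>x\<in>carrier L. \<forall>C\<in>H. \<forall>D\<in>H. vals C x = vals D x \<longrightarrow> P (C, D))"
proof -
  let ?U = "Z_uniformity A L"
  let ?S = "\<lambda>E. {(C, D). C \<in> H \<and> D \<in> H \<and> C \<subseteq> E `` D \<and> D \<subseteq> E `` C}"
  have "eventually P (hyperspace_uniformity (Z A L) ?U) \<longleftrightarrow>
      (\<exists>E\<in>{E. eventually (\<lambda>p. p \<in> E) ?U}. eventually P (principal (?S E)))"
    unfolding hyperspace_uniformity_def
  proof (rule eventually_INF_base)
    have "UNIV \<in> {E. eventually (\<lambda>p. p \<in> E) ?U}" by simp
    then show "{E. eventually (\<lambda>p. p \<in> E) ?U} \<noteq> {}" by blast
    fix D E assume "D \<in> {E. eventually (\<lambda>p. p \<in> E) ?U}" "E \<in> {E. eventually (\<lambda>p. p \<in> E) ?U}"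
    then have DE: "D \<inter> E \<in> {E. eventually (\<lambda>p. p \<in> E) ?U}" by (simp add: eventually_conj)
    have "?S (D \<inter> E) \<subseteq> ?S D \<inter> ?S E" by blast
    then have le: "principal (?S (D \<inter> E)) \<le> inf (principal (?S D)) (principal (?S E))"
      by (simp only: inf_principal principal_le_iff)
    show "\<exists>G\<in>{E. eventually (\<lambda>p. p \<in> E) ?U}.
        principal (?S G) \<le> inf (principal (?S D)) (principal (?S E))"
      using le by (rule bexI[where x = "D \<inter> E", OF _ DE])
  qed
  also have "\<dots> \<longleftrightarrow> (\<exists>x\<in>carrier L. \<forall>C\<in>H. \<forall>D\<in>H. vals C x = vals D x \<longrightarrow> P (C, D))"
  proof safe
    fix E assume "eventually (\<lambda>p. p \<in> E) ?U" and P: "eventually P (principal (?S E))"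
    then obtain x where x: "x \<in> carrier L"
      and E: "\<And>f g. f \<in> Z A L \<Longrightarrow> g \<in> Z A L \<Longrightarrow> f x = g x \<Longrightarrow> (f, g) \<in> E"
      by (auto simp: eventually_Z_uniformity_point)
    have sub: "C \<subseteq> E `` D" if CD: "C \<in> H" "D \<in> H" and eq: "vals C x = vals D x" for C D
    proof
      fix h assume h: "h \<in> C"
      then have "h x \<in> vals D x" unfolding eq[symmetric] by (auto simp: vals_def)
      then obtain g where "g \<in> D" "g x = h x" by (auto simp: vals_def)
      then show "h \<in> E `` D" using E CD h hyperspace_subset by blast
    qed
    have "P (C, D)" if "C \<in> H" "D \<in> H" "vals C x = vals D x" for C D
      using P sub[of C D] sub[of D C] that by (simp add: eventually_principal)
    then show "\<exists>x\<in>carrier L. \<forall>C\<in>H. \<forall>D\<in>H. vals C x = vals D x \<longrightarrow> P (C, D)"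
      using x by blast
  next
    fix x assume x: "x \<in> carrier L" and P: "\<forall>C\<in>H. \<forall>D\<in>H. vals C x = vals D x \<longrightarrow> P (C, D)"
    let ?E = "{(f, g). f x = g x}"
    have "eventually (\<lambda>p. p \<in> ?E) ?U"
      using x by (auto simp: eventually_Z_uniformity_point)
    moreover have "eventually P (principal (?S ?E))"
      unfolding eventually_principal
    proof (clarify)
      fix C D assume CD: "C \<in> H" "D \<in> H" and sub: "C \<subseteq> ?E `` D" "D \<subseteq> ?E `` C"
      have vsub: "vals C' x \<subseteq> vals D' x" if "C' \<subseteq> ?E `` D'" for C' D'
      proof
        fix a assume "a \<in> vals C' x"
        then obtain h where "h \<in> C'" "a = h x" by (auto simp: vals_def)
        then obtain g where "g \<in> D'" "g x = a" using \<open>C' \<subseteq> ?E `` D'\<close> by auto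
        then show "a \<in> vals D' x" by (auto simp: vals_def)
      qed
      have "vals C x = vals D x" by (intro equalityI vsub sub)
      then show "P (C, D)" using P CD by blast
    qed
    ultimately show "\<exists>E\<in>{E. eventually (\<lambda>p. p \<in> E) ?U}. eventually P (principal (?S E))"
      by blast
  qed
  finally show ?thesis .
qed

text \<open>The witness is the largest set of homomorphisms with the given common kernel. It is
  closed because, for a code \<open>z\<close> of \<open>x\<close> and \<open>y\<close>, the
  condition \<open>h x = h y\<close> depends only on \<open>h z\<close>.\<close>

lemma common_kernel_closed:
  assumes C: "C \<subseteq> Z A L"
  obtains D where "D \<in> H" "common_kernel L D = common_kernel L C"
proof -
  define D where "D = {h \<in> Z A L. \<forall>(x, y)\<in>common_kernel L C. h x = h y}"
  have D: "D \<subseteq> Z A L" by (auto simp: D_def)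
  have "h \<in> D" if h: "h \<in> Z A L" and v: "\<forall>x\<in>carrier L. h x \<in> vals D x" for h
  proof -
    have "h x = h y" if xy: "(x, y) \<in> common_kernel L C" for x y
    proof -
      have "x \<in> carrier L" "y \<in> carrier L" using xy by (auto simp: common_kernel_def)
      then obtain z p q where z: "z \<in> carrier L" "p \<in> A \<rightarrow> A" "q \<in> A \<rightarrow> A"
        "x = unary A L p z" "y = unary A L q z"
        using pair_code[OF subuniverse_carrier[OF alg]] by blast
      obtain g where g: "g \<in> D" "h z = g z" using v z(1) by (auto simp: vals_def)
      then have "g x = g y" using xy by (auto simp: D_def)
      then show ?thesis using z g h D by (auto simp: Z_unary)
    qed
    then show ?thesis using h by (auto simp: D_def)
  qed
  then have "D \<in> H" using D by (simp add: hyperspace_iff)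
  moreover have "C \<subseteq> D" using C by (auto simp: D_def common_kernel_def)
  then have "common_kernel L D = common_kernel L C"
    by (auto simp: common_kernel_def D_def)
  ultimately show ?thesis using that by blast
qed

section \<open>Completeness of the hyperspace\<close>

text \<open>The representing family \<open>B\<close> defines a Cauchy filter of closed sets whose
  value sets are eventually those of \<open>B\<close>. Its limit has exactly the value sets
  \<open>B x\<close>, so its common kernel is \<open>\<theta>\<close> by
  \<open>represents_inj\<close>.\<close>

lemma complete_imp_partitionable:
  assumes complete: "complete_on H (hyperspace_uniformity (Z A L) (Z_uniformity A L))"
    and loc: "locally_partitionable_congruence A L \<theta>"
  shows "partitionable_congruence A L \<theta>"
proof -
  let ?U = "hyperspace_uniformity (Z A L) (Z_uniformity A L)"
  have \<theta>: "is_congruence (omega_sig A) L \<theta>"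
    using loc by (simp add: locally_partitionable_congruence_def)
  obtain B where B: "represents A L \<theta> B"
    using locally_partitionable_imp_represents[OF loc] by blast
  let ?G = "\<lambda>x. {C \<in> H. vals C x = B x}"
  define F where "F = (INF x\<in>carrier L. principal (?G x))"
  obtain x0 where x0: "x0 \<in> carrier L"
    using finite_code[OF subuniverse_carrier[OF alg], of "{}"] by blast
  have evF: "eventually P F \<longleftrightarrow> (\<exists>x\<in>carrier L. \<forall>C\<in>?G x. P C)" for P
  proof -
    have "eventually P F \<longleftrightarrow> (\<exists>x\<in>carrier L. eventually P (principal (?G x)))"
      unfolding F_def
    proof (rule eventually_INF_base)
      show "carrier L \<noteq> {}" using x0 by blast
      fix x y assume "x \<in> carrier L" "y \<in> carrier L"
      then obtain z p q where z: "z \<in> carrier L" "p \<in> A \<rightarrow> A" "q \<in> A \<rightarrow> A"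
        "x = unary A L p z" "y = unary A L q z"
        using pair_code[OF subuniverse_carrier[OF alg]] by blast
      \<comment> \<open>The right value set at the code \<open>z\<close> forces the right ones at
        \<open>x\<close> and \<open>y\<close>, since both \<open>vals C\<close> and \<open>B\<close>
        turn unary operations into images.\<close>
      have "?G z \<subseteq> ?G x \<inter> ?G y"
      proof
        fix C assume C: "C \<in> ?G z"
        then have "C \<subseteq> Z A L" using hyperspace_subset by blast
        then show "C \<in> ?G x \<inter> ?G y"
          using C z vals_unary[of C A L] represents_unary[OF B] by simp
      qed
      then show "\<exists>z\<in>carrier L. principal (?G z) \<le> inf (principal (?G x)) (principal (?G y))"
        using z(1) by (auto simp: inf_principal)
    qed
    then show ?thesis by (simp add: eventually_principal)
  qed
  have ne: "?G x \<noteq> {}" if x: "x \<in> carrier L" for x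
  proof -
    \<comment> \<open>Closed, as membership depends only on the value at \<open>x\<close>; by
      \<open>represents_vals_Z\<close> it attains all of \<open>B x\<close>.\<close>
    let ?C = "{h \<in> Z A L. h x \<in> B x}"
    have "?C \<in> H" unfolding hyperspace_iff using x by (auto simp: vals_def)
    moreover have "vals ?C x = B x"
      using represents_vals_Z[OF \<theta> B x] by (auto simp: vals_def)
    ultimately show ?thesis by blast
  qed
  have "\<not> eventually (\<lambda>_. False) F" unfolding evF using ne by blast
  then have bot: "F \<noteq> bot" by (simp add: eventually_False)
  moreover have "F \<le> principal H"
    unfolding le_principal evF using x0 by blast
  moreover have "F \<times>\<^sub>F F \<le> ?U"
  proof (rule filter_leI)
    fix P assume "eventually P ?U"
    then obtain x where x: "x \<in> carrier L"
      and P: "\<And>C D. C \<in> H \<Longrightarrow> D \<in> H \<Longrightarrow> vals C x = vals D x \<Longrightarrow> P (C, D)"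
      unfolding eventually_hyperspace_uniformity by blast
    have "eventually (\<lambda>C. C \<in> ?G x) F" unfolding evF using x by blast
    then show "eventually P (F \<times>\<^sub>F F)"
      unfolding eventually_prod_same using P by (intro exI[of _ "\<lambda>C. C \<in> ?G x"]) auto
  qed
  ultimately obtain C where C: "C \<in> H" and lim: "filtermap (Pair C) F \<le> ?U"
    using complete unfolding complete_on_def by blast
  have CZ: "C \<subseteq> Z A L" using C by (rule hyperspace_subset)
  have "vals C x = B x" if x: "x \<in> carrier L" for x
  proof -
    have "eventually (\<lambda>(C, D). vals C x = vals D x) ?U"
      unfolding eventually_hyperspace_uniformity using x by auto
    then have "eventually (\<lambda>D. vals C x = vals D x) F"
      using filter_leD[OF lim] by (fastforce simp: eventually_filtermap)
    moreover have "eventually (\<lambda>D. vals D x = B x) F" unfolding evF using x by blast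
    ultimately have "eventually (\<lambda>D. vals C x = B x) F" by eventually_elim simp
    then show ?thesis using bot by (simp add: eventually_const_iff)
  qed
  then have "represents A L (common_kernel L C) B"
    using represents_common_kernel[OF alg CZ] represents_cong by blast
  then have "\<theta> = common_kernel L C"
    using represents_inj[OF \<theta> congruence_common_kernel[OF alg CZ] B] by blast
  then show ?thesis using partitionable_congruence_iff[OF alg] CZ by blast
qed

text \<open>Along a Cauchy filter the value set at each \<open>x\<close> is eventually a constant
  \<open>B x\<close>. The eventual common kernel is a congruence represented by \<open>B\<close>,
  hence locally partitionable; a closed set with this common kernel is the limit.\<close>

lemma partitionable_imp_complete:
  assumes part: "\<And>\<theta>. locally_partitionable_congruence A L \<theta> \<Longrightarrow> partitionable_congruence A L \<theta>"
  shows "complete_on H (hyperspace_uniformity (Z A L) (Z_uniformity A L))"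
  unfolding complete_on_def
proof (intro allI impI)
  let ?U = "hyperspace_uniformity (Z A L) (Z_uniformity A L)"
  fix F assume FH: "F \<le> principal H" and bot: "F \<noteq> bot" and cauchy: "F \<times>\<^sub>F F \<le> ?U"
  have evH: "eventually (\<lambda>C. C \<in> H) F" using FH by (simp add: le_principal)
  have "\<exists>b. eventually (\<lambda>C. vals C x = b) F" if x: "x \<in> carrier L" for x
  proof -
    have "eventually (\<lambda>(C, D). vals C x = vals D x) ?U"
      unfolding eventually_hyperspace_uniformity using x by auto
    then have "eventually (\<lambda>(C, D). vals C x = vals D x) (F \<times>\<^sub>F F)"
      using filter_leD[OF cauchy] by blast
    then obtain Q where Q: "eventually Q F" "\<And>C D. Q C \<Longrightarrow> Q D \<Longrightarrow> vals C x = vals D x"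
      unfolding eventually_prod_same by auto
    obtain D where D: "Q D" using Q(1) bot eventually_happens' by blast
    have "eventually (\<lambda>C. vals C x = vals D x) F"
      by (rule eventually_mono[OF Q(1)]) (rule Q(2)[OF _ D])
    then show ?thesis by blast
  qed
  then have "\<forall>x\<in>carrier L. \<exists>b. eventually (\<lambda>C. vals C x = b) F" by blast
  from bchoice[OF this] obtain B where "\<forall>x\<in>carrier L. eventually (\<lambda>C. vals C x = B x) F" ..
  then have evB: "eventually (\<lambda>C. vals C x = B x) F" if "x \<in> carrier L" for x
    using that by simp
  \<comment> \<open>The limit inferior of the common kernels along \<open>F\<close>.\<close>
  define \<theta> where
    "\<theta> = {(x, y) \<in> carrier L \<times> carrier L. eventually (\<lambda>C. (x, y) \<in> common_kernel L C) F}"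
  have "equiv (carrier L) \<theta>"
  proof (intro equivI)
    show "\<theta> \<subseteq> carrier L \<times> carrier L" "refl_on (carrier L) \<theta>"
      by (auto simp: \<theta>_def refl_on_def common_kernel_def)
    show "sym \<theta>"
    proof (rule symI)
      fix x y assume "(x, y) \<in> \<theta>"
      then have xy: "x \<in> carrier L" "y \<in> carrier L"
        and "eventually (\<lambda>C. (x, y) \<in> common_kernel L C) F"
        by (auto simp: \<theta>_def)
      from this(3) have "eventually (\<lambda>C. (y, x) \<in> common_kernel L C) F"
        by eventually_elim (auto simp: common_kernel_def)
      then show "(y, x) \<in> \<theta>" using xy by (simp add: \<theta>_def)
    qed
    show "trans \<theta>"
    proof (rule transI)
      fix x y z assume "(x, y) \<in> \<theta>" "(y, z) \<in> \<theta>"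
      then have xz: "x \<in> carrier L" "z \<in> carrier L"
        and "eventually (\<lambda>C. (x, y) \<in> common_kernel L C) F"
        and "eventually (\<lambda>C. (y, z) \<in> common_kernel L C) F"
        by (auto simp: \<theta>_def)
      from this(3,4) have "eventually (\<lambda>C. (x, z) \<in> common_kernel L C) F"
        by eventually_elim (auto simp: common_kernel_def)
      then show "(x, z) \<in> \<theta>" using xz by (simp add: \<theta>_def)
    qed
  qed
  have \<theta>: "is_congruence (omega_sig A) L \<theta>"
    unfolding is_congruence_def
  proof (intro conjI ballI impI)
    fix s xs ys
    assume s: "s \<in> symbols (omega_sig A)"
      and xs: "xs \<in> tuples (arity (omega_sig A) s) (carrier L)"
      and ys: "ys \<in> tuples (arity (omega_sig A) s) (carrier L)"
      and rel: "list_all2 (\<lambda>x y. (x, y) \<in> \<theta>) xs ys"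
    \<comment> \<open>Arities are finite, so only finitely many eventual conditions have to be
      combined.\<close>
    have "eventually (\<lambda>C. list_all2 (\<lambda>x y. (x, y) \<in> common_kernel L C) xs ys) F"
      using rel
    proof (induction rule: list_all2_induct)
      case (Cons x xs y ys)
      then have "eventually (\<lambda>C. (x, y) \<in> common_kernel L C) F" by (simp add: \<theta>_def)
      with Cons.IH show ?case by eventually_elim simp
    qed simp
    with evH have "eventually (\<lambda>C. (interp L s xs, interp L s ys) \<in> common_kernel L C) F"
    proof eventually_elim
      case (elim C)
      then show ?case
        using congruence_common_kernel[OF alg hyperspace_subset[OF elim(1)]] s xs ys
        by (simp add: is_congruence_def)
    qed
    then show "(interp L s xs, interp L s ys) \<in> \<theta>"
      using alg s xs ys by (simp add: \<theta>_def is_algebra_def)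
  qed (fact \<open>equiv (carrier L) \<theta>\<close>)
  have B: "represents A L \<theta> B"
    unfolding represents_def
  proof (intro ballI conjI)
    fix x assume x: "x \<in> carrier L"
    have ev: "eventually (\<lambda>C. C \<in> H \<and> vals C x = B x) F"
      using evH evB[OF x] by (rule eventually_conj)
    then obtain D where "D \<in> H" "vals D x = B x" using bot eventually_happens' by blast
    then show "B x \<subseteq> A" using vals_subset[OF hyperspace_subset x] by blast
    fix f g assume fg: "f \<in> A \<rightarrow> A" "g \<in> A \<rightarrow> A"
    have "eventually (\<lambda>C. (unary A L f x, unary A L g x) \<in> common_kernel L C
        \<longleftrightarrow> (\<forall>a\<in>B x. f a = g a)) F"
      using ev
    proof eventually_elim
      case (elim C)
      then show ?case
        using represents_iff[OF represents_common_kernel[OF alg hyperspace_subset] x fg, of C]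
        by simp
    qed
    \<comment> \<open>The right-hand condition does not depend on \<open>C\<close>, so for the
      proper filter \<open>F\<close> it holds eventually iff it holds.\<close>
    then have "eventually (\<lambda>C. (unary A L f x, unary A L g x) \<in> common_kernel L C) F
        \<longleftrightarrow> eventually (\<lambda>C. \<forall>a\<in>B x. f a = g a) F"
      by (rule eventually_subst)
    then show "(unary A L f x, unary A L g x) \<in> \<theta> \<longleftrightarrow> (\<forall>a\<in>B x. f a = g a)"
      using bot unary_closed fg x by (simp add: \<theta>_def eventually_const_iff)
  qed
  have "partitionable_congruence A L \<theta>"
    by (rule part[OF represents_imp_locally_partitionable[OF \<theta> B]])
  then obtain C' where "C' \<subseteq> Z A L" "\<theta> = common_kernel L C'"
    using partitionable_congruence_iff[OF alg] by blast
  \<comment> \<open>The limit must be a point of the hyperspace, so \<open>C'\<close> is replaced by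
    a closed set with the same kernel.\<close>
  then obtain C where C: "C \<in> H" "\<theta> = common_kernel L C"
    using common_kernel_closed by metis
  have "represents A L \<theta> (vals C)"
    using represents_common_kernel[OF alg hyperspace_subset[OF C(1)]] C(2) by simp
  then have CB: "vals C x = B x" if "x \<in> carrier L" for x
    using represents_unique[OF inf _ B that] by blast
  have "filtermap (Pair C) F \<le> ?U"
  proof (rule filter_leI)
    fix P assume "eventually P ?U"
    then obtain x where x: "x \<in> carrier L"
      and P: "\<And>C D. C \<in> H \<Longrightarrow> D \<in> H \<Longrightarrow> vals C x = vals D x \<Longrightarrow> P (C, D)"
      unfolding eventually_hyperspace_uniformity by blast
    have "eventually (\<lambda>D. P (C, D)) F"
      using evH evB[OF x] by eventually_elim (use P C(1) CB[OF x] in auto)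
    then show "eventually P (filtermap (Pair C) F)" by (simp add: eventually_filtermap)
  qed
  then show "\<exists>C\<in>H. filtermap (Pair C) F \<le> ?U" using C(1) by blast
qed

end

theorem theorem2p9:
  fixes A :: "'a set" and L :: "('a omega_sym, 'x) algebra"
  assumes "infinite A"
    and "in_V_omega A L"
    and "partitionable A L"
  shows "supercomplete (Z A L) (Z_uniformity A L) \<longleftrightarrow>
    (\<forall>\<theta>. locally_partitionable_congruence A L \<theta> \<longrightarrow> partitionable_congruence A L \<theta>)"
proof -
  have alg: "is_algebra (omega_sig A) L"
    using assms(2) by (simp add: in_V_omega_def in_variety_of_def)
  interpret separated_omega_algebra A L
    by (rule separated_omega_algebra.intro[OF assms(1) alg partitionable_Z_separates[OF alg assms(3)]])
  show ?thesis
    \<comment> \<open>\<open>Z A L\<close> always carries a separated uniformity, so what remains is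
      completeness of its hyperspace.\<close>
    unfolding supercomplete_def
    using uniform_on_Z separated_on_Z complete_imp_partitionable partitionable_imp_complete by blast
qed

end
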